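(* Let $\mathbb{K}$ be a field, let $n\ge 1$, let $Q$ be the equioriented quiver of type $\mathbb{A}_n$, and let $V$ be a nonzero persistence module, i.e. a nonzero finite-dimensional representation of $Q$ over $\mathbb{K}$. Let $j_1<\dots<j_\ell$ be the collection of all indices $j\in\{0,\dots,n-1\}$ satisfying $[0,j]\in\mathbf{Bar}(V)$. Let $V^\bullet$ be the Harder-Narasimhan filtration of $V$ along the Euler stability condition $\epsilon$. Then $V^\bullet$ has length $\ell+1$, and for each integer $0<k\le \ell$ the quotient $S^k:=V^k/V^{k-1}$ satisfies $$\dim (S^k)_{x_i}=\begin{cases} d_{0,j_k} & \text{if } i\in[0,j_k],\\ 0 & \text{otherwise.}\end{cases}$$
   Context: The equioriented quiver of type $\mathbb{A}_n$ has vertices $x_0,\dots,x_{n-1}$ and edges $e_i:x_{i-1}\to x_i$ for $1\le i\le n-1$. For integers $0\le u\le v\le n-1$, the interval module $\mathbf{I}[u,v]$ is the representation with $\mathbb{K}$ at $x_i$ for $i\in[u,v]$ and $0$ at other vertices, whose edge maps are $\mathrm{id}_{\mathbb{K}}$ whenever source and target are both nonzero, and zero otherwise. Every finite-dimensional representation $V$ decomposes as $V\simeq\bigoplus_{[u,v]\in\mathbf{Bar}(V)}\mathbf{I}[u,v]^{d_{u,v}}$ for a unique finite set $\mathbf{Bar}(V)$ of intervals (the barcode) and unique multiplicities $d_{u,v}\in\mathbb{N}_{>0}$. For a finite acyclic quiver with vertex set $Q_0$ and a function $\alpha:Q_0\to\mathbb{R}$ (a stability condition), the $\alpha$-slope of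 a nonzero finite-dimensional representation $V$ is $\phi_\alpha(V)=\frac{\sum_{x\in Q_0}\alpha_x\dim V_x}{\sum_{x\in Q_0}\dim V_x}$. A nonzero $V$ is $\alpha$-semistable if $\phi_\alpha(U)\le\phi_\alpha(V)$ for every nonzero subrepresentation $U\subset V$. The Harder-Narasimhan (HN) filtration of $V\neq 0$ along $\alpha$ is the unique filtration $0=V^0\subsetneq V^1\subsetneq\dots\subsetneq V^m=V$ by subrepresentations whose successive quotients $V^j/V^{j-1}$ are $\alpha$-semistable with strictly decreasing $\alpha$-slopes; its length is $m$. The Euler stability condition is $\epsilon(x):=1-\deg_{\mathrm{in}}(x)$, where $\deg_{\mathrm{in}}(x)$ is the number of edges with target $x$.
   Formalization: The length is proved to be ℓ+1 when some bar [u,v] of V has u>0, and ℓ when every bar starts at 0; in the latter case the stated length ℓ+1 is false (e.g. n=1, V=I[0,0] is semistable, with ℓ=1 and filtration length 1). *)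

theory Defs
  imports "Graph_Theory.Digraph" "Jordan_Normal_Form.Missing_VectorSpace" "HOL-Algebra.AbelCoset"
    Complex_Main
begin

text \<open>A quiver is a directed multigraph, i.e. a \<^typ>\<open>('q, 'e) pre_digraph\<close>. In a representation
  every vertex carries its own vector space (own carrier and own operations); only the underlying
  HOL type of vectors is shared.\<close>

record ('q, 'e, 'k, 'v) quiver_rep =
  vspace :: "'q \<Rightarrow> ('k, 'v) module"
  edge_map :: "'e \<Rightarrow> 'v \<Rightarrow> 'v"

definition fd_rep ::
  "('k, 'r) ring_scheme \<Rightarrow> ('q, 'e) pre_digraph \<Rightarrow> ('q, 'e, 'k, 'v) quiver_rep \<Rightarrow> bool" where
  "fd_rep K Q V \<longleftrightarrow>
     (\<forall>x\<in>verts Q. vectorspace K (vspace V x) \<and> vectorspace.fin_dim K (vspace V x)) \<and>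
     (\<forall>e\<in>arcs Q. linear_map K (vspace V (tail Q e)) (vspace V (head Q e)) (edge_map V e))"

definition nonzero_rep :: "('q, 'e) pre_digraph \<Rightarrow> ('q, 'e, 'k, 'v) quiver_rep \<Rightarrow> bool" where
  "nonzero_rep Q V \<longleftrightarrow> (\<exists>x\<in>verts Q. carrier (vspace V x) \<noteq> {\<zero>\<^bsub>vspace V x\<^esub>})"

definition rep_iso ::
  "('k, 'r) ring_scheme \<Rightarrow> ('q, 'e) pre_digraph \<Rightarrow> ('q, 'e, 'k, 'v) quiver_rep \<Rightarrow>
   ('q, 'e, 'k, 'w) quiver_rep \<Rightarrow> bool" where
  "rep_iso K Q V W \<longleftrightarrow> (\<exists>\<phi>.
     (\<forall>x\<in>verts Q. linear_map K (vspace V x) (vspace W x) (\<phi> x) \<and>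
        bij_betw (\<phi> x) (carrier (vspace V x)) (carrier (vspace W x))) \<and>
     (\<forall>e\<in>arcs Q. \<forall>v\<in>carrier (vspace V (tail Q e)).
        \<phi> (head Q e) (edge_map V e v) = edge_map W e (\<phi> (tail Q e) v)))"


text \<open>A subrepresentation is given by its family of subspaces.\<close>

definition is_subrep ::
  "('k, 'r) ring_scheme \<Rightarrow> ('q, 'e) pre_digraph \<Rightarrow> ('q, 'e, 'k, 'v) quiver_rep \<Rightarrow>
   ('q \<Rightarrow> 'v set) \<Rightarrow> bool" where
  "is_subrep K Q V U \<longleftrightarrow>
     (\<forall>x\<in>verts Q. subspace K (U x) (vspace V x)) \<and>
     (\<forall>e\<in>arcs Q. edge_map V e ` U (tail Q e) \<subseteq> U (head Q e))"

definition restrict_rep ::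
  "('q, 'e, 'k, 'v) quiver_rep \<Rightarrow> ('q \<Rightarrow> 'v set) \<Rightarrow> ('q, 'e, 'k, 'v) quiver_rep" where
  "restrict_rep V U =
     \<lparr>vspace = (\<lambda>x. (vspace V x)\<lparr>carrier := U x\<rparr>), edge_map = edge_map V\<rparr>"


text \<open>Quotients are spaces of cosets. Ring multiplication and unit of a \<^typ>\<open>('k, 'v) module\<close>
  record play no role in a vector space; here and below they are filled with arbitrary values.\<close>

definition quot_space :: "('k, 'v) module \<Rightarrow> 'v set \<Rightarrow> ('k, 'v set) module" where
  "quot_space M U =
     \<lparr>carrier = a_rcosets\<^bsub>M\<^esub> U, mult = (\<lambda>C D. U), one = U, zero = U,
      add = (\<lambda>C D. C <+>\<^bsub>M\<^esub> D),
      smult = (\<lambda>c C. \<Union>v\<in>C. U +>\<^bsub>M\<^esub> (c \<odot>\<^bsub>M\<^esub> v))\<rparr>"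

definition quot_rep ::
  "('q, 'e) pre_digraph \<Rightarrow> ('q, 'e, 'k, 'v) quiver_rep \<Rightarrow> ('q \<Rightarrow> 'v set) \<Rightarrow>
   ('q, 'e, 'k, 'v set) quiver_rep" where
  "quot_rep Q V U =
     \<lparr>vspace = (\<lambda>x. quot_space (vspace V x) (U x)),
      edge_map = (\<lambda>e C. \<Union>v\<in>C. U (head Q e) +>\<^bsub>vspace V (head Q e)\<^esub> edge_map V e v)\<rparr>"


definition slope ::
  "('k, 'r) ring_scheme \<Rightarrow> ('q, 'e) pre_digraph \<Rightarrow> ('q \<Rightarrow> real) \<Rightarrow>
   ('q, 'e, 'k, 'v) quiver_rep \<Rightarrow> real" where
  "slope K Q \<alpha> V =
     (\<Sum>x\<in>verts Q. \<alpha> x * real (vectorspace.dim K (vspace V x))) /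
     (\<Sum>x\<in>verts Q. real (vectorspace.dim K (vspace V x)))"

definition semistable ::
  "('k, 'r) ring_scheme \<Rightarrow> ('q, 'e) pre_digraph \<Rightarrow> ('q \<Rightarrow> real) \<Rightarrow>
   ('q, 'e, 'k, 'v) quiver_rep \<Rightarrow> bool" where
  "semistable K Q \<alpha> V \<longleftrightarrow> nonzero_rep Q V \<and>
     (\<forall>U. is_subrep K Q V U \<and> nonzero_rep Q (restrict_rep V U) \<longrightarrow>
        slope K Q \<alpha> (restrict_rep V U) \<le> slope K Q \<alpha> V)"

definition filtration_quot ::
  "('q, 'e) pre_digraph \<Rightarrow> ('q, 'e, 'k, 'v) quiver_rep \<Rightarrow> (nat \<Rightarrow> 'q \<Rightarrow> 'v set) \<Rightarrow> nat \<Rightarrow>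
   ('q, 'e, 'k, 'v set) quiver_rep" where
  "filtration_quot Q V F j = quot_rep Q (restrict_rep V (F j)) (F (j - 1))"

text \<open>The filtration is \<open>F 0, \<dots>, F m\<close>; the values \<open>F j\<close> with \<open>j > m\<close> (and the values of \<open>F j\<close> outside
  the vertex set) are irrelevant. All inclusions are strict, so \<open>m\<close> counts nonzero quotients only.\<close>

definition HN_filtration ::
  "('k, 'r) ring_scheme \<Rightarrow> ('q, 'e) pre_digraph \<Rightarrow> ('q \<Rightarrow> real) \<Rightarrow>
   ('q, 'e, 'k, 'v) quiver_rep \<Rightarrow> nat \<Rightarrow> (nat \<Rightarrow> 'q \<Rightarrow> 'v set) \<Rightarrow> bool" where
  "HN_filtration K Q \<alpha> V m F \<longleftrightarrow>
     (\<forall>j\<le>m. is_subrep K Q V (F j)) \<and>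
     (\<forall>x\<in>verts Q. F 0 x = {\<zero>\<^bsub>vspace V x\<^esub>}) \<and>
     (\<forall>x\<in>verts Q. F m x = carrier (vspace V x)) \<and>
     (\<forall>j\<in>{1..m}. (\<forall>x\<in>verts Q. F (j - 1) x \<subseteq> F j x) \<and> (\<exists>x\<in>verts Q. F (j - 1) x \<noteq> F j x)) \<and>
     (\<forall>j\<in>{1..m}. semistable K Q \<alpha> (filtration_quot Q V F j)) \<and>
     (\<forall>j\<in>{1..<m}. slope K Q \<alpha> (filtration_quot Q V F (j + 1))
                    < slope K Q \<alpha> (filtration_quot Q V F j))"

definition euler_stability :: "('q, 'e) pre_digraph \<Rightarrow> 'q \<Rightarrow> real" where
  "euler_stability Q x = 1 - real (in_degree Q x)"


definition equi_A :: "nat \<Rightarrow> (nat, nat) pre_digraph" where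
  "equi_A n = \<lparr>verts = {0..<n}, arcs = {1..<n}, tail = (\<lambda>i. i - 1), head = (\<lambda>i. i)\<rparr>"

definition interval_rep ::
  "('k, 'r) ring_scheme \<Rightarrow> nat \<times> nat \<Rightarrow> (nat, nat, 'k, 'k) quiver_rep" where
  "interval_rep K = (\<lambda>(u, v).
     \<lparr>vspace = (\<lambda>i. \<lparr>carrier = (if i \<in> {u..v} then carrier K else {\<zero>\<^bsub>K\<^esub>}),
                     mult = mult K, one = one K, zero = zero K, add = add K, smult = mult K\<rparr>),
      edge_map = (\<lambda>i a. if i - 1 \<in> {u..v} \<and> i \<in> {u..v} then a else \<zero>\<^bsub>K\<^esub>)\<rparr>)"

text \<open>Direct sum over an index set \<open>J\<close>, realised as the product; it is only used for finite \<open>J\<close>.\<close>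

definition direct_sum_rep ::
  "'j set \<Rightarrow> ('j \<Rightarrow> ('q, 'e, 'k, 'w) quiver_rep) \<Rightarrow> ('q, 'e, 'k, 'j \<Rightarrow> 'w) quiver_rep" where
  "direct_sum_rep J W =
     \<lparr>vspace = (\<lambda>x.
        \<lparr>carrier = (\<Pi>\<^sub>E j\<in>J. carrier (vspace (W j) x)),
         mult = (\<lambda>f g. \<lambda>j\<in>J. \<zero>\<^bsub>vspace (W j) x\<^esub>), one = (\<lambda>j\<in>J. \<zero>\<^bsub>vspace (W j) x\<^esub>),
         zero = (\<lambda>j\<in>J. \<zero>\<^bsub>vspace (W j) x\<^esub>),
         add = (\<lambda>f g. \<lambda>j\<in>J. f j \<oplus>\<^bsub>vspace (W j) x\<^esub> g j),
         smult = (\<lambda>c f. \<lambda>j\<in>J. c \<odot>\<^bsub>vspace (W j) x\<^esub> f j)\<rparr>),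
      edge_map = (\<lambda>e f. \<lambda>j\<in>J. edge_map (W j) e (f j))\<rparr>"

text \<open>\<open>B\<close> is the barcode of \<open>V\<close> and \<open>d\<close> gives the multiplicities (only its values on \<open>B\<close> matter).
  The summands are indexed by pairs of a bar and a copy number.\<close>

definition is_barcode ::
  "('k, 'r) ring_scheme \<Rightarrow> nat \<Rightarrow> (nat, nat, 'k, 'v) quiver_rep \<Rightarrow> (nat \<times> nat) set \<Rightarrow>
   (nat \<times> nat \<Rightarrow> nat) \<Rightarrow> bool" where
  "is_barcode K n V B d \<longleftrightarrow>
     B \<subseteq> {(u, v). u \<le> v \<and> v \<le> n - 1} \<and> (\<forall>b\<in>B. 0 < d b) \<and>
     rep_iso K (equi_A n) V
       (direct_sum_rep (Sigma B (\<lambda>b. {0..<d b})) (\<lambda>(b, r). interval_rep K b))"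

end

theory Submission
  imports Defs
begin

text \<open>
  For the Euler stability condition on the equioriented quiver of type A, the slope of a
  representation \<open>S\<close> is \<open>dim S\<^sub>0 / (\<Sum>i. dim S\<^sub>i)\<close>: vertex \<open>0\<close> is the only source, and every other
  vertex has stability \<open>0\<close>. Thus only the part of a representation that is born at vertex \<open>0\<close>
  contributes to the numerator. The Harder-Narasimhan filtration is analysed directly, through its
  defining properties.

  The key point (\<open>semistable_push_surj\<close>, \<open>semistable_shape\<close>) is that a semistable \<open>S\<close> of positive
  slope looks like a power of one interval module \<open>I[0,c]\<close>. Two kinds of test subrepresentations
  suffice, both generated by a subspace of \<open>S\<^sub>0\<close>. The one generated by all of \<open>S\<^sub>0\<close> has the same
  numerator and at most the same denominator as \<open>S\<close>, so semistability forces it to be \<open>S\<close>: all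
  edge maps are surjective. The one generated by a single nonzero vector that dies on entering
  vertex \<open>c + 1\<close> has slope at least \<open>1 / (c + 1)\<close>; if it is one of the vectors that die first, then
  \<open>S\<close> has full dimension \<open>dim S\<^sub>0\<close> on \<open>[0,c]\<close>, and semistability leaves no room for anything after
  \<open>c\<close>.

  Since the slopes strictly decrease and are nonnegative, all quotients of the filtration have
  positive slope, except possibly the last one. The positive ones have shapes \<open>[0, c 1], [0, c 2], \<dots>\<close>
  with \<open>c\<close> strictly increasing, because the slope is \<open>1 / (c k + 1)\<close>. Surjectivity of the edge maps
  passes from the quotients to the filtration, so the last step \<open>L\<close> of positive slope consists of
  the images of \<open>V\<^sub>0\<close> (\<open>HN_positive_part\<close>). Therefore the rank of \<open>V\<^sub>0 \<rightarrow> V\<^sub>i\<close> is the sum of the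
  dimensions of the quotients at \<open>i\<close>; by the barcode it is also the number of bars \<open>[0,v]\<close> with
  \<open>i \<le> v\<close>, counted with multiplicity (\<open>barcode_dims\<close>). Both descriptions of this function of \<open>i\<close>
  determine where it drops and by how much, which identifies the \<open>c k\<close> with the right ends of the
  bars starting at \<open>0\<close>, and the dimensions with the multiplicities (\<open>rank_drops_determine\<close>).
  Finally there is one more step, of slope \<open>0\<close>, exactly if the images of \<open>V\<^sub>0\<close> do not exhaust \<open>V\<close>,
  that is, if some bar starts after \<open>0\<close>.
\<close>

section \<open>Subspaces, linear maps and dimension\<close>

lemma subspaceI:
  assumes "vectorspace K M" "U \<subseteq> carrier M" "\<zero>\<^bsub>M\<^esub> \<in> U"
    "\<And>v w. v \<in> U \<Longrightarrow> w \<in> U \<Longrightarrow> v \<oplus>\<^bsub>M\<^esub> w \<in> U"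
    "\<And>c v. c \<in> carrier K \<Longrightarrow> v \<in> U \<Longrightarrow> c \<odot>\<^bsub>M\<^esub> v \<in> U"
  shows "subspace K U M"
  using assms unfolding subspace_def LinearCombinations.submodule_def vectorspace_def by auto

lemma subspaceD:
  assumes "subspace K U M"
  shows "vectorspace K M" "U \<subseteq> carrier M" "\<zero>\<^bsub>M\<^esub> \<in> U"
    "v \<in> U \<Longrightarrow> w \<in> U \<Longrightarrow> v \<oplus>\<^bsub>M\<^esub> w \<in> U"
    "c \<in> carrier K \<Longrightarrow> v \<in> U \<Longrightarrow> c \<odot>\<^bsub>M\<^esub> v \<in> U"
    "vectorspace K (M\<lparr>carrier := U\<rparr>)"
  using assms vectorspace.subspace_is_vs[of K M U]
  unfolding subspace_def LinearCombinations.submodule_def by auto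

lemma linear_mapI:
  assumes "vectorspace K M" "vectorspace K N" "\<And>v. v \<in> carrier M \<Longrightarrow> f v \<in> carrier N"
    "\<And>v w. v \<in> carrier M \<Longrightarrow> w \<in> carrier M \<Longrightarrow> f (v \<oplus>\<^bsub>M\<^esub> w) = f v \<oplus>\<^bsub>N\<^esub> f w"
    "\<And>c v. c \<in> carrier K \<Longrightarrow> v \<in> carrier M \<Longrightarrow> f (c \<odot>\<^bsub>M\<^esub> v) = c \<odot>\<^bsub>N\<^esub> f v"
  shows "linear_map K M N f"
  using assms
  unfolding linear_map_def mod_hom_def mod_hom_axioms_def module_hom_def vectorspace_def by auto

lemma linear_mapD:
  assumes "linear_map K M N f"
  shows "vectorspace K M" "vectorspace K N" "v \<in> carrier M \<Longrightarrow> f v \<in> carrier N"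
    "v \<in> carrier M \<Longrightarrow> w \<in> carrier M \<Longrightarrow> f (v \<oplus>\<^bsub>M\<^esub> w) = f v \<oplus>\<^bsub>N\<^esub> f w"
    "c \<in> carrier K \<Longrightarrow> v \<in> carrier M \<Longrightarrow> f (c \<odot>\<^bsub>M\<^esub> v) = c \<odot>\<^bsub>N\<^esub> f v"
    "f \<zero>\<^bsub>M\<^esub> = \<zero>\<^bsub>N\<^esub>"
proof -
  interpret linear_map K M N f by fact
  show "vectorspace K M" "vectorspace K N" "v \<in> carrier M \<Longrightarrow> f v \<in> carrier N"
    "v \<in> carrier M \<Longrightarrow> w \<in> carrier M \<Longrightarrow> f (v \<oplus>\<^bsub>M\<^esub> w) = f v \<oplus>\<^bsub>N\<^esub> f w"
    "c \<in> carrier K \<Longrightarrow> v \<in> carrier M \<Longrightarrow> f (c \<odot>\<^bsub>M\<^esub> v) = c \<odot>\<^bsub>N\<^esub> f v"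
    "f \<zero>\<^bsub>M\<^esub> = \<zero>\<^bsub>N\<^esub>"
    using V.vectorspace_axioms W.vectorspace_axioms by auto
qed

lemma linear_map_restrict:
  assumes f: "linear_map K M N f" and U: "subspace K U M" and W: "subspace K W N" and "f ` U \<subseteq> W"
  shows "linear_map K (M\<lparr>carrier := U\<rparr>) (N\<lparr>carrier := W\<rparr>) f"
  using assms linear_mapD[OF f] subspaceD[OF U] subspaceD[OF W]
  by (intro linear_mapI) (auto simp: subset_iff)

lemma linear_map_comp:
  assumes f: "linear_map K M N f" and g: "linear_map K N P g"
  shows "linear_map K M P (g \<circ> f)"
  using linear_mapD[OF f] linear_mapD[OF g] by (intro linear_mapI) auto

lemma linear_map_id: "vectorspace K M \<Longrightarrow> linear_map K M M id"
  by (intro linear_mapI) auto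

lemma subspace_zero:
  assumes "vectorspace K M"
  shows "subspace K {\<zero>\<^bsub>M\<^esub>} M"
proof -
  interpret vectorspace K M by fact
  show ?thesis using assms by (intro subspaceI) auto
qed

lemma subspace_carrier:
  assumes "vectorspace K M"
  shows "subspace K (carrier M) M"
proof -
  interpret vectorspace K M by fact
  show ?thesis using assms by (intro subspaceI) auto
qed

lemma subspace_nested:
  assumes "subspace K U M" "subspace K W M" "U \<subseteq> W"
  shows "subspace K U (M\<lparr>carrier := W\<rparr>)"
  using assms(3) subspaceD[OF assms(1)] subspaceD[OF assms(2)] by (intro subspaceI) auto

lemma subspace_image:
  assumes f: "linear_map K M N f" and U: "subspace K U M"
  shows "subspace K (f ` U) N"
proof (rule subspaceI)
  note fD = linear_mapD[OF f] and UD = subspaceD[OF U]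
  show "vectorspace K N" by fact
  show "f ` U \<subseteq> carrier N" using fD(3) UD(2) by auto
  show "\<zero>\<^bsub>N\<^esub> \<in> f ` U" using fD(6) UD(3) by force
  fix v w assume "v \<in> f ` U" "w \<in> f ` U"
  then obtain x y where xy: "v = f x" "w = f y" "x \<in> U" "y \<in> U" by auto
  then have "v \<oplus>\<^bsub>N\<^esub> w = f (x \<oplus>\<^bsub>M\<^esub> y)" using fD(4)[of x y] subsetD[OF UD(2)] by auto
  then show "v \<oplus>\<^bsub>N\<^esub> w \<in> f ` U" using xy UD(4) by auto
next
  note fD = linear_mapD[OF f] and UD = subspaceD[OF U]
  fix c v assume c: "c \<in> carrier K" "v \<in> f ` U"
  then obtain x where xy: "v = f x" "x \<in> U" by auto
  then have "c \<odot>\<^bsub>N\<^esub> v = f (c \<odot>\<^bsub>M\<^esub> x)" using fD(5)[of c x] subsetD[OF UD(2)] c by auto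
  then show "c \<odot>\<^bsub>N\<^esub> v \<in> f ` U" using xy UD(5) c by auto
qed

text \<open>A linearly independent subset of \<open>U\<close> is independent in \<open>M\<close>, so its size is at most \<open>dim M\<close>;
  a maximal one is a finite basis of \<open>U\<close>.\<close>

lemma subspace_fin_dim:
  assumes U: "subspace K U M" and fd: "vectorspace.fin_dim K M"
  shows "vectorspace.fin_dim K (M\<lparr>carrier := U\<rparr>)"
proof -
  interpret M: vectorspace K M using subspaceD(1)[OF U] .
  interpret U: vectorspace K "M\<lparr>carrier := U\<rparr>" using subspaceD(6)[OF U] .
  have sm: "LinearCombinations.submodule K U M" using U by (simp add: subspace_def)
  have small: "finite A \<and> card A \<le> M.dim" if "A \<subseteq> U" "U.lin_indpt A" for A
    using that M.li_le_dim[OF fd, of A] M.span_li_not_depend(2)[OF that(1) sm] subspaceD(2)[OF U]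
    by auto
  have "U.lin_indpt {}" by (auto simp: U.lin_dep_def)
  then have "\<exists>A. finite A \<and> maximal A (\<lambda>S. S \<subseteq> carrier (M\<lparr>carrier := U\<rparr>) \<and> U.lin_indpt S)"
    using small by (intro maximal_exists[where N = "M.dim" and B = "{}"]) auto
  then obtain A where "finite A" "U.basis A"
    using U.max_li_is_basis by auto
  then show ?thesis unfolding U.fin_dim_def U.basis_def by auto
qed

lemma rank_nullity_surj:
  assumes f: "linear_map K M N f" and fd: "vectorspace.fin_dim K M"
    and surj: "f ` carrier M = carrier N"
  shows "vectorspace.dim K M = vectorspace.dim K N +
      vectorspace.dim K (M\<lparr>carrier := {v \<in> carrier M. f v = \<zero>\<^bsub>N\<^esub>}\<rparr>)"
proof -
  interpret linear_map K M N f by fact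
  have "imT = carrier N" "kerT = {v \<in> carrier M. f v = \<zero>\<^bsub>N\<^esub>}"
    using surj by (auto simp: im_def ker_def)
  then show ?thesis using rank_nullity[OF fd] by simp
qed

lemma surj_fin_dim:
  assumes f: "linear_map K M N f" and fd: "vectorspace.fin_dim K M"
    and surj: "f ` carrier M = carrier N"
  shows "vectorspace.fin_dim K N"
  using linear_map.surj_fin_dim[OF f fd surj] .

lemma bij_dim_eq:
  assumes f: "linear_map K M N f" and fd: "vectorspace.fin_dim K M"
    and bij: "bij_betw f (carrier M) (carrier N)"
  shows "vectorspace.dim K N = vectorspace.dim K M"
  using linear_map.dim_eq[OF f fd] bij by (simp add: bij_betw_def)

lemma dim_0_iff:
  assumes "vectorspace K M" "vectorspace.fin_dim K M"
  shows "vectorspace.dim K M = 0 \<longleftrightarrow> carrier M = {\<zero>\<^bsub>M\<^esub>}"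
proof -
  interpret vectorspace K M by fact
  show ?thesis
  proof
    assume 0: "dim = 0"
    obtain A where A: "finite A" "basis A" using finite_basis_exists assms(2) by auto
    then have "A = {}" using dim_basis 0 by auto
    then show "carrier M = {\<zero>\<^bsub>M\<^esub>}" using A span_empty by (auto simp: basis_def)
  next
    assume c: "carrier M = {\<zero>\<^bsub>M\<^esub>}"
    show "dim = 0" by (rule dim0I) (use c span_self[of "\<zero>\<^bsub>M\<^esub>"] span_closed[of "{\<zero>\<^bsub>M\<^esub>}"] in auto)
  qed
qed

lemma dim_zero_space: "vectorspace K M \<Longrightarrow> vectorspace.dim K (M\<lparr>carrier := {\<zero>\<^bsub>M\<^esub>}\<rparr>) = 0"
proof -
  assume M: "vectorspace K M"
  interpret Z: vectorspace K "M\<lparr>carrier := {\<zero>\<^bsub>M\<^esub>}\<rparr>" using subspaceD(6)[OF subspace_zero[OF M]] .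
  show ?thesis
    using Z.dim0I Z.span_self[of "\<zero>\<^bsub>M\<^esub>"] Z.span_closed[of "{\<zero>\<^bsub>M\<^esub>}"] by auto
qed

lemma dim_image_le:
  assumes f: "linear_map K M N f" and U: "subspace K U M" and fd: "vectorspace.fin_dim K M"
  shows "vectorspace.dim K (N\<lparr>carrier := f ` U\<rparr>) \<le> vectorspace.dim K (M\<lparr>carrier := U\<rparr>)"
  using rank_nullity_surj[OF linear_map_restrict[OF f U subspace_image[OF f U] order_refl]]
    subspace_fin_dim[OF U fd] by auto

lemma dim_span_singleton:
  assumes "vectorspace K M" "v \<in> carrier M" "v \<noteq> \<zero>\<^bsub>M\<^esub>"
  shows "vectorspace.dim K (M\<lparr>carrier := module.span K M {v}\<rparr>) = 1"
proof -
  interpret vectorspace K M by fact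
  have s: "subspace K (span {v}) M" using assms by (intro span_is_subspace) auto
  interpret S: vectorspace K "M\<lparr>carrier := span {v}\<rparr>" using subspaceD(6)[OF s] .
  have sm: "LinearCombinations.submodule K (span {v}) M" using s by (simp add: subspace_def)
  have "v \<in> span {v}" using assms span_self by auto
  then show ?thesis
    using span_li_not_depend(1)[OF _ sm, of "{v}"] assms by (intro S.dim1I[of v]) auto
qed

lemma kernel_subspace:
  assumes f: "linear_map K M N f"
  shows "subspace K {v \<in> carrier M. f v = \<zero>\<^bsub>N\<^esub>} M"
proof -
  interpret linear_map K M N f by fact
  show ?thesis using kerT_is_subspace by (simp add: ker_def)
qed

lemma inj_on_linear_iff:
  assumes f: "linear_map K M N f"
  shows "inj_on f (carrier M) \<longleftrightarrow> (\<forall>v\<in>carrier M. f v = \<zero>\<^bsub>N\<^esub> \<longrightarrow> v = \<zero>\<^bsub>M\<^esub>)"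
proof -
  interpret linear_map K M N f by fact
  show ?thesis unfolding Ke0_iff_inj by (auto simp: ker_def)
qed


section \<open>Quotient spaces and quotient representations\<close>

lemma subspace_abelian_subgroup:
  assumes "subspace K U M"
  shows "abelian_subgroup U M"
proof -
  interpret vectorspace K M using subspaceD(1)[OF assms] .
  note D = subspaceD[OF assms]
  have "\<ominus>\<^bsub>M\<^esub> v \<in> U" if "v \<in> U" for v
    using D(5)[of "\<ominus>\<^bsub>K\<^esub> \<one>\<^bsub>K\<^esub>" v] smult_minus_1[of v] subsetD[OF D(2) that] that by auto
  then have "subgroup U (add_monoid M)"
    using D by (intro subgroup.intro) (auto simp: a_inv_def[symmetric])
  then show ?thesis
    by (rule abelian_subgroupI3[OF additive_subgroup.intro M.abelian_group_axioms])
qed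

lemma coset_eq_iff:
  assumes "subspace K U M" "v \<in> carrier M" "w \<in> carrier M"
  shows "U +>\<^bsub>M\<^esub> v = U +>\<^bsub>M\<^esub> w \<longleftrightarrow> v \<in> U +>\<^bsub>M\<^esub> w"
proof -
  interpret abelian_subgroup U M using subspace_abelian_subgroup[OF assms(1)] .
  show ?thesis using a_repr_independence'[of v w] a_repr_independenceD[of v w] assms 
    by (metis a_rcos_self)
qed

lemma mem_coset_iff: "w \<in> U +>\<^bsub>M\<^esub> v \<longleftrightarrow> (\<exists>u\<in>U. w = u \<oplus>\<^bsub>M\<^esub> v)"
  by (auto simp: a_r_coset_def')

text \<open>The maps induced on quotients are given as unions over a coset. This lemma evaluates such a
  union at a representative; it serves both for scalar multiplication and for edge maps.\<close>

lemma coset_image: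
  assumes f: "linear_map K M N f" and U: "subspace K U M" and W: "subspace K W N"
    and fU: "f ` U \<subseteq> W" and v: "v \<in> carrier M"
  shows "(\<Union>x\<in>U +>\<^bsub>M\<^esub> v. W +>\<^bsub>N\<^esub> f x) = W +>\<^bsub>N\<^esub> f v"
proof -
  interpret M: vectorspace K M using subspaceD(1)[OF U] .
  interpret U: abelian_subgroup U M using subspace_abelian_subgroup[OF U] .
  note fD = linear_mapD[OF f] and UD = subspaceD[OF U]
  have "W +>\<^bsub>N\<^esub> f x = W +>\<^bsub>N\<^esub> f v" if x: "x \<in> U +>\<^bsub>M\<^esub> v" for x
  proof -
    obtain u where u: "u \<in> U" "x = u \<oplus>\<^bsub>M\<^esub> v" using x unfolding mem_coset_iff by auto
    then have uM: "u \<in> carrier M" and xM: "x \<in> carrier M" using UD v by auto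
    have "f x = f u \<oplus>\<^bsub>N\<^esub> f v" using fD(4)[OF uM v] u by simp
    moreover have "f x \<in> carrier N" using fD(3)[OF xM] .
    moreover have "f u \<in> W" using u(1) fU by auto
    ultimately show ?thesis using coset_eq_iff[OF W, of "f x" "f v"] fD(3)[OF v]
      by (auto simp: mem_coset_iff)
  qed
  moreover have "v \<in> U +>\<^bsub>M\<^esub> v" using U.a_rcos_self[OF v] .
  ultimately show ?thesis by blast
qed

lemma quot_carrier: "carrier (quot_space M U) = (\<lambda>v. U +>\<^bsub>M\<^esub> v) ` carrier M"
  by (auto simp: quot_space_def A_RCOSETS_def')

lemma quot_zero:
  assumes U: "subspace K U M"
  shows "\<zero>\<^bsub>quot_space M U\<^esub> = U +>\<^bsub>M\<^esub> \<zero>\<^bsub>M\<^esub>"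
proof -
  interpret vectorspace K M using subspaceD(1)[OF U] .
  show ?thesis using subspaceD(2)[OF U] by (simp add: quot_space_def)
qed

lemma quot_add:
  assumes U: "subspace K U M" and "v \<in> carrier M" "w \<in> carrier M"
  shows "(U +>\<^bsub>M\<^esub> v) \<oplus>\<^bsub>quot_space M U\<^esub> (U +>\<^bsub>M\<^esub> w) = U +>\<^bsub>M\<^esub> (v \<oplus>\<^bsub>M\<^esub> w)"
proof -
  interpret abelian_subgroup U M using subspace_abelian_subgroup[OF U] .
  show ?thesis using a_rcos_sum[of v w] assms by (simp add: quot_space_def)
qed

lemma smult_linear:
  assumes "vectorspace K M" and c: "c \<in> carrier K"
  shows "linear_map K M M (\<lambda>v. c \<odot>\<^bsub>M\<^esub> v)"
proof -
  interpret vectorspace K M by fact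
  show ?thesis using c assms
    by (intro linear_mapI) (auto simp: smult_r_distr smult_assoc1[symmetric] m_comm)
qed

lemma quot_smult:
  assumes U: "subspace K U M" and c: "c \<in> carrier K" and v: "v \<in> carrier M"
  shows "c \<odot>\<^bsub>quot_space M U\<^esub> (U +>\<^bsub>M\<^esub> v) = U +>\<^bsub>M\<^esub> (c \<odot>\<^bsub>M\<^esub> v)"
  using coset_image[OF smult_linear[OF subspaceD(1)[OF U] c] U U _ v] subspaceD(5)[OF U c]
  by (auto simp: quot_space_def)

lemma quot_vectorspace:
  assumes U: "subspace K U M"
  shows "vectorspace K (quot_space M U)"
proof -
  interpret vectorspace K M using subspaceD(1)[OF U] .
  note [simp] = quot_carrier quot_zero[OF U] quot_add[OF U] quot_smult[OF U]
  show ?thesis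
  proof (rule vs_criteria)
    show "\<forall>v\<in>carrier (quot_space M U). \<exists>neg_v\<in>carrier (quot_space M U).
      v \<oplus>\<^bsub>quot_space M U\<^esub> neg_v = \<zero>\<^bsub>quot_space M U\<^esub>"
    proof
      fix C assume "C \<in> carrier (quot_space M U)"
      then obtain v where v: "v \<in> carrier M" "C = U +>\<^bsub>M\<^esub> v" by auto
      then have "C \<oplus>\<^bsub>quot_space M U\<^esub> (U +>\<^bsub>M\<^esub> (\<ominus>\<^bsub>M\<^esub> v)) = \<zero>\<^bsub>quot_space M U\<^esub>"
        by (simp add: r_neg del: M.a_coset_add_zero)
      then show "\<exists>neg_v\<in>carrier (quot_space M U).
          C \<oplus>\<^bsub>quot_space M U\<^esub> neg_v = \<zero>\<^bsub>quot_space M U\<^esub>"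
        using v by force
    qed
  qed (auto simp: M.a_ac smult_assoc1 smult_l_distr smult_r_distr field_axioms 
      simp del: M.a_coset_add_zero)
qed

lemma quot_map_linear:
  assumes U: "subspace K U M"
  shows "linear_map K M (quot_space M U) (\<lambda>v. U +>\<^bsub>M\<^esub> v)"
  using quot_add[OF U] quot_smult[OF U]
  by (intro linear_mapI subspaceD(1)[OF U] quot_vectorspace[OF U]) (auto simp: quot_carrier)

lemma quot_fin_dim:
  assumes U: "subspace K U M" and fd: "vectorspace.fin_dim K M"
  shows "vectorspace.fin_dim K (quot_space M U)"
  using surj_fin_dim[OF quot_map_linear[OF U] fd] by (simp add: quot_carrier)

lemma quot_eq_iff_zero:
  assumes U: "subspace K U M" and v: "v \<in> carrier M"
  shows "U +>\<^bsub>M\<^esub> v = \<zero>\<^bsub>quot_space M U\<^esub> \<longleftrightarrow> v \<in> U"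
proof -
  interpret vectorspace K M using subspaceD(1)[OF U] .
  show ?thesis
    unfolding quot_zero[OF U] coset_eq_iff[OF U v M.zero_closed] mem_coset_iff
    using subspaceD(2)[OF U] by force
qed

lemma quot_dim:
  assumes U: "subspace K U M" and fd: "vectorspace.fin_dim K M"
  shows "vectorspace.dim K M =
    vectorspace.dim K (quot_space M U) + vectorspace.dim K (M\<lparr>carrier := U\<rparr>)"
proof -
  interpret vectorspace K M using subspaceD(1)[OF U] .
  have "U +>\<^bsub>M\<^esub> v = \<zero>\<^bsub>quot_space M U\<^esub> \<longleftrightarrow> v \<in> U" if "v \<in> carrier M" for v
    using quot_eq_iff_zero[OF U that] .
  then have "{v \<in> carrier M. U +>\<^bsub>M\<^esub> v = \<zero>\<^bsub>quot_space M U\<^esub>} = U"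
    using subspaceD(2)[OF U] by auto
  then show ?thesis
    using rank_nullity_surj[OF quot_map_linear[OF U] fd] by (simp add: quot_carrier)
qed

text \<open>A subspace of full dimension is everything, because the quotient by it has dimension \<open>0\<close>.\<close>

lemma dim_le_carrier:
  fixes M :: "('k, 'v) module"
  assumes U: "subspace K U M" and fd: "vectorspace.fin_dim K M"
  shows "vectorspace.dim K (M\<lparr>carrier := U\<rparr>) \<le> vectorspace.dim K M"
    "vectorspace.dim K (M\<lparr>carrier := U\<rparr>) = vectorspace.dim K M \<longleftrightarrow> U = carrier M"
proof -
  show "vectorspace.dim K (M\<lparr>carrier := U\<rparr>) \<le> vectorspace.dim K M"
    using quot_dim[OF U fd] by simp
  show "vectorspace.dim K (M\<lparr>carrier := U\<rparr>) = vectorspace.dim K M \<longleftrightarrow> U = carrier M"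
  proof
    assume "vectorspace.dim K (M\<lparr>carrier := U\<rparr>) = vectorspace.dim K M"
    then have "carrier (quot_space M U) = {\<zero>\<^bsub>quot_space M U\<^esub>}"
      using quot_dim[OF U fd] dim_0_iff[OF quot_vectorspace[OF U] quot_fin_dim[OF U fd]] by simp
    then have "v \<in> U" if "v \<in> carrier M" for v
      using quot_eq_iff_zero[OF U that] that by (auto simp: quot_carrier)
    then show "U = carrier M" using subspaceD(2)[OF U] by auto
  qed simp
qed

lemma subrep_vertexD:
  assumes "is_subrep K Q V U" "x \<in> verts Q"
  shows "subspace K (U x) (vspace V x)"
  using assms by (auto simp: is_subrep_def)

lemma fd_rep_vertexD:
  assumes "fd_rep K Q V" "x \<in> verts Q"
  shows "vectorspace K (vspace V x)" "vectorspace.fin_dim K (vspace V x)"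
  using assms by (auto simp: fd_rep_def)

lemma fd_rep_edgeD:
  assumes "fd_rep K Q V" "e \<in> arcs Q"
  shows "linear_map K (vspace V (tail Q e)) (vspace V (head Q e)) (edge_map V e)"
  using assms by (auto simp: fd_rep_def)

lemma fd_rep_restrict:
  assumes V: "fd_rep K Q V" and U: "is_subrep K Q V U"
    and wf: "\<And>e. e \<in> arcs Q \<Longrightarrow> tail Q e \<in> verts Q \<and> head Q e \<in> verts Q"
  shows "fd_rep K Q (restrict_rep V U)"
  unfolding fd_rep_def
proof (intro conjI ballI)
  fix x assume x: "x \<in> verts Q"
  note s = subrep_vertexD[OF U x]
  show "vectorspace K (vspace (restrict_rep V U) x)"
    "vectorspace.fin_dim K (vspace (restrict_rep V U) x)"
    using subspaceD(6)[OF s] subspace_fin_dim[OF s fd_rep_vertexD(2)[OF V x]]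
    by (auto simp: restrict_rep_def)
next
  fix e assume e: "e \<in> arcs Q"
  show "linear_map K (vspace (restrict_rep V U) (tail Q e)) (vspace (restrict_rep V U) (head Q e))
      (edge_map (restrict_rep V U) e)"
    using linear_map_restrict[OF fd_rep_edgeD[OF V e] subrep_vertexD[OF U] subrep_vertexD[OF U]]
      wf[OF e] U e by (simp add: restrict_rep_def is_subrep_def)
qed

lemma fd_rep_quot:
  assumes V: "fd_rep K Q V" and U: "is_subrep K Q V U"
    and wf: "\<And>e. e \<in> arcs Q \<Longrightarrow> tail Q e \<in> verts Q \<and> head Q e \<in> verts Q"
  shows "fd_rep K Q (quot_rep Q V U)"
  unfolding fd_rep_def
proof (intro conjI ballI)
  fix x assume x: "x \<in> verts Q"
  note s = subrep_vertexD[OF U x]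
  show "vectorspace K (vspace (quot_rep Q V U) x)"
    "vectorspace.fin_dim K (vspace (quot_rep Q V U) x)"
    using quot_vectorspace[OF s] quot_fin_dim[OF s fd_rep_vertexD(2)[OF V x]]
    by (auto simp: quot_rep_def)
next
  fix e assume e: "e \<in> arcs Q"
  let ?T = "vspace V (tail Q e)" and ?H = "vspace V (head Q e)"
  let ?UT = "U (tail Q e)" and ?UH = "U (head Q e)"
  note f = fd_rep_edgeD[OF V e]
  have T: "subspace K ?UT ?T" and H: "subspace K ?UH ?H"
    using wf[OF e] subrep_vertexD[OF U] by auto
  interpret T: vectorspace K ?T using subspaceD(1)[OF T] .
  have q: "edge_map (quot_rep Q V U) e (?UT +>\<^bsub>?T\<^esub> v) = ?UH +>\<^bsub>?H\<^esub> edge_map V e v"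
    if "v \<in> carrier ?T" for v
    using coset_image[OF f T H _ that] U e by (simp add: quot_rep_def is_subrep_def)
  have "linear_map K (quot_space ?T ?UT) (quot_space ?H ?UH) (edge_map (quot_rep Q V U) e)"
  proof (rule linear_mapI)
    fix C D assume "C \<in> carrier (quot_space ?T ?UT)" "D \<in> carrier (quot_space ?T ?UT)"
    then obtain v w where v: "v \<in> carrier ?T" "C = ?UT +>\<^bsub>?T\<^esub> v"
      and w: "w \<in> carrier ?T" "D = ?UT +>\<^bsub>?T\<^esub> w" by (auto simp: quot_carrier)
    show "edge_map (quot_rep Q V U) e (C \<oplus>\<^bsub>quot_space ?T ?UT\<^esub> D) =
        edge_map (quot_rep Q V U) e C \<oplus>\<^bsub>quot_space ?H ?UH\<^esub> edge_map (quot_rep Q V U) e D"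
      unfolding v(2) w(2) quot_add[OF T v(1) w(1)] q[OF v(1)] q[OF w(1)]
        q[OF T.a_closed[OF v(1) w(1)]]
        quot_add[OF H linear_mapD(3)[OF f v(1)] linear_mapD(3)[OF f w(1)]]
      using linear_mapD(4)[OF f v(1) w(1)] by simp
  next
    fix c C assume c: "c \<in> carrier K" and "C \<in> carrier (quot_space ?T ?UT)"
    then obtain v where v: "v \<in> carrier ?T" "C = ?UT +>\<^bsub>?T\<^esub> v" by (auto simp: quot_carrier)
    show "edge_map (quot_rep Q V U) e (c \<odot>\<^bsub>quot_space ?T ?UT\<^esub> C) =
        c \<odot>\<^bsub>quot_space ?H ?UH\<^esub> edge_map (quot_rep Q V U) e C"
      unfolding v(2) quot_smult[OF T c v(1)] q[OF v(1)] q[OF T.smult_closed[OF c v(1)]]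
        quot_smult[OF H c linear_mapD(3)[OF f v(1)]]
      using linear_mapD(5)[OF f c v(1)] by simp
  next
    fix C assume "C \<in> carrier (quot_space ?T ?UT)"
    then show "edge_map (quot_rep Q V U) e C \<in> carrier (quot_space ?H ?UH)"
      using q linear_mapD(3)[OF f] by (auto simp: quot_carrier)
  qed (use quot_vectorspace T H in auto)
  then show "linear_map K (vspace (quot_rep Q V U) (tail Q e)) (vspace (quot_rep Q V U) (head Q e))
      (edge_map (quot_rep Q V U) e)"
    by (simp add: quot_rep_def)
qed


section \<open>Semistable representations for the Euler stability condition\<close>

lemma equi_A_simps [simp]:
  "verts (equi_A n) = {0..<n}" "arcs (equi_A n) = {1..<n}"
  "tail (equi_A n) e = e - 1" "head (equi_A n) e = e"
  by (simp_all add: equi_A_def)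

lemma equi_A_wf: "e \<in> arcs (equi_A n) \<Longrightarrow> tail (equi_A n) e \<in> verts (equi_A n) \<and> head (equi_A n) e \<in> verts (equi_A n)"
  by auto

text \<open>The composite \<open>V\<^sub>0 \<rightarrow> V\<^sub>1 \<rightarrow> \<dots> \<rightarrow> V\<^sub>i\<close> of the edge maps; edge \<open>i\<close> runs from \<open>i - 1\<close> to \<open>i\<close>.\<close>

primrec push :: "(nat, nat, 'k, 'v) quiver_rep \<Rightarrow> nat \<Rightarrow> 'v \<Rightarrow> 'v" where
  "push V 0 = id"
| "push V (Suc i) = edge_map V (Suc i) \<circ> push V i"

lemma push_linear:
  assumes V: "fd_rep K (equi_A n) V" and "i < n"
  shows "linear_map K (vspace V 0) (vspace V i) (push V i)"
  using assms(2)
proof (induction i)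
  case 0
  then show ?case unfolding push.simps(1) by (intro linear_map_id fd_rep_vertexD(1)[OF V]) simp
next
  case (Suc i)
  then have "linear_map K (vspace V i) (vspace V (Suc i)) (edge_map V (Suc i))"
    using fd_rep_edgeD[OF V, of "Suc i"] by simp
  with Suc show ?case unfolding push.simps(2) by (intro linear_map_comp[of K _ "vspace V i"]) auto
qed

text \<open>This is the subrepresentation generated by a subspace of \<open>V\<^sub>0\<close>. All test objects for
  semistability below are of this form.\<close>

lemma push_subrep:
  assumes V: "fd_rep K (equi_A n) V" and U: "subspace K U (vspace V 0)"
  shows "is_subrep K (equi_A n) V (\<lambda>i. push V i ` U)"
  unfolding is_subrep_def
proof (intro conjI ballI)
  fix i assume "i \<in> verts (equi_A n)"
  then show "subspace K (push V i ` U) (vspace V i)"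
    using subspace_image[OF push_linear[OF V] U] by simp
next
  fix e assume "e \<in> arcs (equi_A n)"
  then obtain i where "e = Suc i" by (cases e) auto
  then show "edge_map V e ` push V (tail (equi_A n) e) ` U \<subseteq> push V (head (equi_A n) e) ` U"
    by (auto simp: image_image)
qed

lemma euler_stability_equi_A:
  assumes "i < n"
  shows "euler_stability (equi_A n) i = (if i = 0 then 1 else 0)"
proof -
  have "in_arcs (equi_A n) i = (if i = 0 then {} else {i})"
    using assms by (auto simp: in_arcs_def)
  then show ?thesis by (simp add: euler_stability_def in_degree_def)
qed

lemma slope_equi_A:
  assumes "n \<ge> 1"
  shows "slope K (equi_A n) (euler_stability (equi_A n)) V =
    real (vectorspace.dim K (vspace V 0)) / real (\<Sum>i\<in>{0..<n}. vectorspace.dim K (vspace V i))"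
proof -
  have "(\<Sum>i\<in>{0..<n}. euler_stability (equi_A n) i * real (vectorspace.dim K (vspace V i))) =
      (\<Sum>i\<in>{0..<n}. if i = 0 then real (vectorspace.dim K (vspace V 0)) else 0)"
    by (intro sum.cong) (auto simp: euler_stability_equi_A)
  then show ?thesis using assms by (simp add: slope_def)
qed

lemma nonzero_rep_iff_dim:
  assumes "fd_rep K (equi_A n) V"
  shows "nonzero_rep (equi_A n) V \<longleftrightarrow> 0 < (\<Sum>i\<in>{0..<n}. vectorspace.dim K (vspace V i))"
proof -
  have "carrier (vspace V i) = {\<zero>\<^bsub>vspace V i\<^esub>} \<longleftrightarrow> vectorspace.dim K (vspace V i) = 0"
    if "i \<in> {0..<n}" for i
    using dim_0_iff[OF fd_rep_vertexD[OF assms, of i]] that by simp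
  then show ?thesis unfolding nonzero_rep_def zero_less_iff_neq_zero by simp
qed

text \<open>The semistability inequality against a generated subrepresentation, cleared of denominators so
  that it can be used in the natural numbers.\<close>

lemma semistable_generated_le:
  assumes n: "n \<ge> 1" and V: "fd_rep K (equi_A n) V"
    and ss: "semistable K (equi_A n) (euler_stability (equi_A n)) V"
    and U: "subspace K U (vspace V 0)" and U0: "U \<noteq> {\<zero>\<^bsub>vspace V 0\<^esub>}"
  shows "vectorspace.dim K (vspace V 0\<lparr>carrier := U\<rparr>) * (\<Sum>i\<in>{0..<n}. vectorspace.dim K (vspace V i))
    \<le> vectorspace.dim K (vspace V 0) *
      (\<Sum>i\<in>{0..<n}. vectorspace.dim K (vspace V i\<lparr>carrier := push V i ` U\<rparr>))"
proof -
  let ?R = "restrict_rep V (\<lambda>i. push V i ` U)"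
  note sub = push_subrep[OF V U]
  have nz: "nonzero_rep (equi_A n) ?R"
    using U0 n by (auto simp: nonzero_rep_def restrict_rep_def intro!: bexI[of _ 0])
  have pos: "0 < (\<Sum>i\<in>{0..<n}. vectorspace.dim K (vspace ?R i))"
    "0 < (\<Sum>i\<in>{0..<n}. vectorspace.dim K (vspace V i))"
    using nz ss nonzero_rep_iff_dim[OF fd_rep_restrict[OF V sub equi_A_wf]] nonzero_rep_iff_dim[OF V]
    by (auto simp: semistable_def)
  have cross: "a * d \<le> c * b" if "a / b \<le> c / d" "0 < b" "0 < d" for a b c d :: real
    using that by (simp add: field_simps)
  have "slope K (equi_A n) (euler_stability (equi_A n)) ?R
      \<le> slope K (equi_A n) (euler_stability (equi_A n)) V"
    using ss sub nz by (auto simp: semistable_def)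
  then have "real (vectorspace.dim K (vspace ?R 0)) * real (\<Sum>i\<in>{0..<n}. vectorspace.dim K (vspace V i))
    \<le> real (vectorspace.dim K (vspace V 0)) * real (\<Sum>i\<in>{0..<n}. vectorspace.dim K (vspace ?R i))"
    using pos cross unfolding slope_equi_A[OF n] of_nat_0_less_iff[symmetric, where 'a = real] by blast
  then have "vectorspace.dim K (vspace ?R 0) * (\<Sum>i\<in>{0..<n}. vectorspace.dim K (vspace V i))
    \<le> vectorspace.dim K (vspace V 0) * (\<Sum>i\<in>{0..<n}. vectorspace.dim K (vspace ?R i))"
    unfolding of_nat_mult[symmetric] of_nat_le_iff .
  then show ?thesis by (simp add: restrict_rep_def)
qed

text \<open>The subrepresentation generated by \<open>V\<^sub>0\<close> has the same dimension at vertex \<open>0\<close> as \<open>V\<close>. If it were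
  proper, its total dimension would be smaller and its slope larger than that of \<open>V\<close>.\<close>

lemma semistable_push_surj:
  assumes n: "n \<ge> 1" and V: "fd_rep K (equi_A n) V"
    and ss: "semistable K (equi_A n) (euler_stability (equi_A n)) V"
    and pos: "0 < vectorspace.dim K (vspace V 0)" and i: "i < n"
  shows "push V i ` carrier (vspace V 0) = carrier (vspace V i)"
proof -
  let ?d = "\<lambda>i. vectorspace.dim K (vspace V i)"
  let ?e = "\<lambda>i. vectorspace.dim K (vspace V i\<lparr>carrier := push V i ` carrier (vspace V 0)\<rparr>)"
  have V0: "vectorspace K (vspace V 0)" "vectorspace.fin_dim K (vspace V 0)"
    using fd_rep_vertexD[OF V, of 0] n by auto
  note s = subspace_image[OF push_linear[OF V] subspace_carrier[OF V0(1)]]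
  have ne: "carrier (vspace V 0) \<noteq> {\<zero>\<^bsub>vspace V 0\<^esub>}"
    using dim_0_iff[OF V0] pos by auto
  have "?d 0 * (\<Sum>i\<in>{0..<n}. ?d i) \<le> ?d 0 * (\<Sum>i\<in>{0..<n}. ?e i)"
    using semistable_generated_le[OF n V ss subspace_carrier[OF V0(1)] ne] by simp
  then have "(\<Sum>i\<in>{0..<n}. ?d i) \<le> (\<Sum>i\<in>{0..<n}. ?e i)" using pos by simp
  moreover have le: "?e i \<le> ?d i" if "i \<in> {0..<n}" for i
    using dim_le_carrier(1)[OF s] fd_rep_vertexD[OF V, of i] that by simp
  ultimately have "(\<Sum>i\<in>{0..<n}. ?e i) = (\<Sum>i\<in>{0..<n}. ?d i)"
    using sum_mono[of "{0..<n}" ?e ?d, OF le] by simp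
  then have "?e i = ?d i"
    by (rule sum_mono_inv) (use le i in auto)
  then show ?thesis
    using dim_le_carrier(2)[OF s[OF i]] fd_rep_vertexD[OF V, of i] i by simp
qed

lemma push_zero_mono:
  assumes V: "fd_rep K (equi_A n) V" and v: "v \<in> carrier (vspace V 0)"
    and "push V i v = \<zero>\<^bsub>vspace V i\<^esub>" "i \<le> k" "k < n"
  shows "push V k v = \<zero>\<^bsub>vspace V k\<^esub>"
  using assms(4,5)
proof (induction k rule: dec_induct)
  case base then show ?case using assms by simp
next
  case (step k)
  then show ?case
    using linear_mapD(6)[OF fd_rep_edgeD[OF V, of "Suc k", simplified]] by simp
qed

text \<open>As long as \<open>V\<^sub>0 \<rightarrow> V\<^sub>i\<close> is injective, it is an isomorphism, and \<open>V\<^sub>i\<close> has the dimension of \<open>V\<^sub>0\<close>. At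
  the first vertex where injectivity fails, a vector of the kernel generates a subrepresentation
  that is at most one-dimensional at each earlier vertex and zero from there on; its large slope
  bounds the total dimension of \<open>V\<close> by what the earlier vertices already use up.\<close>

lemma semistable_shape:
  assumes n: "n \<ge> 1" and V: "fd_rep K (equi_A n) V"
    and ss: "semistable K (equi_A n) (euler_stability (equi_A n)) V"
    and pos: "0 < vectorspace.dim K (vspace V 0)"
  shows "\<exists>c<n. \<forall>i<n. vectorspace.dim K (vspace V i) =
    (if i \<le> c then vectorspace.dim K (vspace V 0) else 0)"
proof -
  let ?d = "\<lambda>i. vectorspace.dim K (vspace V i)"
  define P where "P i \<longleftrightarrow> inj_on (push V i) (carrier (vspace V 0))" for i
  have V0: "vectorspace K (vspace V 0)" "vectorspace.fin_dim K (vspace V 0)"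
    using fd_rep_vertexD[OF V, of 0] n by auto
  \<comment> \<open>a name for the dimension at \<open>0\<close>, as the equation \<open>?d i = ?d 0\<close> would rewrite its own right side\<close>
  define D where "D = ?d 0"
  have d_P: "?d i = D" if "i < n" "P i" for i
    using bij_dim_eq[OF push_linear[OF V that(1)] V0(2)]
      semistable_push_surj[OF n V ss pos that(1)] that(2) by (simp add: P_def D_def bij_betw_def)
  have "\<exists>c<n. \<forall>i<n. ?d i = (if i \<le> c then D else 0)"
  proof (cases "\<forall>i<n. P i")
    case True
    then show ?thesis using d_P n by (intro exI[of _ "n - 1"]) auto
  next
    case False
    \<comment> \<open>the first vertex at which some vector of \<open>V\<^sub>0\<close> has died; the interval is \<open>[0, c - 1]\<close>\<close>
    define c where "c = (LEAST i. i < n \<and> \<not> P i)"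
    have c: "c < n" "\<not> P c" using False LeastI_ex[of "\<lambda>i. i < n \<and> \<not> P i"] by (auto simp: c_def)
    have less: "P i" if "i < c" for i using not_less_Least[of i "\<lambda>i. i < n \<and> \<not> P i"] that c(1)
      by (auto simp: c_def)
    have "P 0" by (simp add: P_def)
    then have "c \<noteq> 0" using c(2) by metis
    obtain v where v: "v \<in> carrier (vspace V 0)" "push V c v = \<zero>\<^bsub>vspace V c\<^esub>" "v \<noteq> \<zero>\<^bsub>vspace V 0\<^esub>"
      using c inj_on_linear_iff[OF push_linear[OF V c(1)]] by (auto simp: P_def)
    interpret V0: vectorspace K "vspace V 0" by fact
    define U where "U = V0.span {v}"
    have U: "subspace K U (vspace V 0)" using V0.span_is_subspace[of "{v}"] v by (simp add: U_def)
    have vU: "v \<in> U" using V0.span_self v by (simp add: U_def)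
    have nz: "U \<noteq> {\<zero>\<^bsub>vspace V 0\<^esub>}" using vU v(3) by auto
    have dU: "vectorspace.dim K (vspace V 0\<lparr>carrier := U\<rparr>) = 1"
      using dim_span_singleton[OF V0(1) v(1,3)] by (simp add: U_def)
    let ?e = "\<lambda>i. vectorspace.dim K (vspace V i\<lparr>carrier := push V i ` U\<rparr>)"
    have e1: "?e i \<le> 1" if "i < n" for i
      using dim_image_le[OF push_linear[OF V that] U V0(2)] dU by simp
    have e0: "?e i = 0" if "c \<le> i" "i < n" for i
    proof -
      have "push V i v = \<zero>\<^bsub>vspace V i\<^esub>" using push_zero_mono[OF V v(1,2) that] .
      moreover have s: "subspace K {w \<in> carrier (vspace V 0). push V i w = \<zero>\<^bsub>vspace V i\<^esub>} (vspace V 0)"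
        using kernel_subspace[OF push_linear[OF V that(2)]] .
      ultimately have "U \<subseteq> {w \<in> carrier (vspace V 0). push V i w = \<zero>\<^bsub>vspace V i\<^esub>}"
        using V0.span_is_subset[OF _ V0.is_module[OF s], of "{v}"] v by (simp add: U_def)
      then have "push V i ` U = {\<zero>\<^bsub>vspace V i\<^esub>}" using vU by force
      then show ?thesis using dim_zero_space[OF fd_rep_vertexD(1)[OF V, of i]] that by simp
    qed
    have "(\<Sum>i\<in>{0..<n}. ?e i) \<le> (\<Sum>i\<in>{0..<n}. if i < c then 1 else 0)"
      using e0 e1 by (intro sum_mono) (auto simp: not_less)
    also have "\<dots> = c" using c(1) by (simp add: sum.If_cases Int_def conj_commute cong: conj_cong)
    finally have le: "D * (\<Sum>i\<in>{0..<n}. ?e i) \<le> D * c" by simp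
    have D: "(\<Sum>i\<in>{0..<n}. ?d i) \<le> D * c"
      using semistable_generated_le[OF n V ss U nz] le unfolding dU D_def by linarith
    have "(\<Sum>i\<in>{0..<n}. ?d i) = (\<Sum>i\<in>{0..<c}. ?d i) + (\<Sum>i\<in>{c..<n}. ?d i)"
      using c(1) by (simp add: sum.atLeastLessThan_concat)
    moreover have "(\<Sum>i\<in>{0..<c}. ?d i) = D * c" using d_P less c(1) by simp
    ultimately have "(\<Sum>i\<in>{c..<n}. ?d i) = 0" using D by simp
    then have "?d i = 0" if "c \<le> i" "i < n" for i using that by simp
    then have "\<forall>i<n. ?d i = (if i \<le> c - 1 then D else 0)"
      using d_P less \<open>c \<noteq> 0\<close> by auto
    then show ?thesis using c(1) by (intro exI[of _ "c - 1"]) auto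
  qed
  then show ?thesis unfolding D_def .
qed


section \<open>Dimensions and ranks from the barcode\<close>

text \<open>The field as a vector space over itself, the target of the coordinate functions below.\<close>

definition line :: "('k, 'r) ring_scheme \<Rightarrow> ('k, 'k) module" where
  "line K = \<lparr>carrier = carrier K, mult = mult K, one = one K, zero = zero K, add = add K,
     smult = mult K\<rparr>"

lemma line_vectorspace:
  assumes "field K"
  shows "vectorspace K (line K)"
proof -
  interpret field K by fact
  have "\<exists>y\<in>carrier K. x \<oplus>\<^bsub>K\<^esub> y = \<zero>\<^bsub>K\<^esub>" if "x \<in> carrier K" for x
    using that r_neg by (intro bexI[of _ "\<ominus>\<^bsub>K\<^esub> x"]) auto
  then show ?thesis using assms
    by (intro vs_criteria) (auto simp: line_def a_ac m_assoc l_distr r_distr)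
qed

lemma line_dim:
  assumes "field K"
  shows "vectorspace.dim K (line K) = 1"
proof -
  interpret field K by fact
  interpret L: vectorspace K "line K" using line_vectorspace[OF assms] .
  have s: "subspace K (L.span {\<one>\<^bsub>K\<^esub>}) (line K)"
    by (intro L.span_is_subspace) (simp add: line_def)
  have one: "\<one>\<^bsub>K\<^esub> \<in> L.span {\<one>\<^bsub>K\<^esub>}" by (intro L.span_self) (simp add: line_def)
  have "x \<in> L.span {\<one>\<^bsub>K\<^esub>}" if "x \<in> carrier K" for x
    using subspaceD(5)[OF s that one] that by (simp add: line_def)
  then have "L.span {\<one>\<^bsub>K\<^esub>} = carrier (line K)"
    using subspaceD(2)[OF s] by (auto simp: line_def)
  then show ?thesis by (intro L.dim1I[of "\<one>\<^bsub>K\<^esub>"]) (auto simp: line_def)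
qed

text \<open>Families indexed by \<open>J\<close> that vanish outside \<open>T\<close>. In a sum of interval modules, the space at a
  vertex and the image of the space at vertex \<open>0\<close> are both of this form.\<close>

definition supported_on :: "('k, 'r) ring_scheme \<Rightarrow> 'j set \<Rightarrow> 'j set \<Rightarrow> ('j \<Rightarrow> 'k) set" where
  "supported_on K J T = (\<Pi>\<^sub>E j\<in>J. if j \<in> T then carrier K else {\<zero>\<^bsub>K\<^esub>})"

lemma supported_on_iff:
  assumes "field K"
  shows "f \<in> supported_on K J T \<longleftrightarrow>
    f \<in> extensional J \<and> (\<forall>j\<in>J. f j \<in> carrier K \<and> (j \<notin> T \<longrightarrow> f j = \<zero>\<^bsub>K\<^esub>))"
proof -
  interpret field K by fact
  show ?thesis by (auto simp: supported_on_def PiE_iff split: if_splits)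
qed

text \<open>By induction on \<open>T\<close>: the coordinate function of a new index \<open>j\<close> is a surjection onto the field,
  and its kernel consists of the families that vanish at \<open>j\<close>. The ambient space \<open>M\<close> provides
  finite dimensionality.\<close>

lemma dim_supported_on:
  fixes K :: "('k, 'r) ring_scheme" and M :: "('k, 'j \<Rightarrow> 'k) module"
  assumes M: "vectorspace K M" and fd: "vectorspace.fin_dim K M"
    and carr: "carrier M = supported_on K J S"
    and zero: "\<zero>\<^bsub>M\<^esub> = (\<lambda>j\<in>J. \<zero>\<^bsub>K\<^esub>)"
    and add: "\<And>f g. f \<oplus>\<^bsub>M\<^esub> g = (\<lambda>j\<in>J. f j \<oplus>\<^bsub>K\<^esub> g j)"
    and smult: "\<And>c f. c \<odot>\<^bsub>M\<^esub> f = (\<lambda>j\<in>J. c \<otimes>\<^bsub>K\<^esub> f j)"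
    and "finite T" "T \<subseteq> S" "T \<subseteq> J"
  shows "subspace K (supported_on K J T) M \<and>
    vectorspace.dim K (M\<lparr>carrier := supported_on K J T\<rparr>) = card T"
  using assms(7-9)
proof (induction T rule: finite_induct)
  case empty
  have "supported_on K J {} = {\<zero>\<^bsub>M\<^esub>}"
    by (auto simp: supported_on_def zero PiE_eq_singleton)
  then show ?case using subspace_zero[OF M] dim_zero_space[OF M] by simp
next
  case (insert j T)
  interpret vectorspace K M by fact
  let ?X = "supported_on K J (insert j T)"
  note iff = supported_on_iff[OF field_axioms]
  have IH: "vectorspace.dim K (M\<lparr>carrier := supported_on K J T\<rparr>) = card T"
    using insert by auto
  have coord: "f i \<in> carrier K" if "f \<in> supported_on K J T'" "i \<in> J" for f i and T' :: "'j set"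
    using that by (auto simp: iff)
  have X: "subspace K ?X M"
  proof (rule subspaceI[OF M])
    show "?X \<subseteq> carrier M" using insert.prems
      by (fastforce simp: carr iff)
    show "\<zero>\<^bsub>M\<^esub> \<in> ?X" by (auto simp: zero iff)
    fix f g assume "f \<in> ?X" "g \<in> ?X"
    then show "f \<oplus>\<^bsub>M\<^esub> g \<in> ?X" by (auto simp: add iff)
  next
    fix c f assume "c \<in> carrier K" "f \<in> ?X"
    then show "c \<odot>\<^bsub>M\<^esub> f \<in> ?X" by (auto simp: smult iff)
  qed
  have j: "j \<in> J" using insert.prems by auto
  have lin: "linear_map K (M\<lparr>carrier := ?X\<rparr>) (line K) (\<lambda>f. f j)"
    using coord j line_vectorspace[OF field_axioms] subspaceD(6)[OF X]
    by (intro linear_mapI) (auto simp: line_def add smult)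
  have surj: "(\<lambda>f. f j) ` carrier (M\<lparr>carrier := ?X\<rparr>) = carrier (line K)"
  proof
    show "(\<lambda>f. f j) ` carrier (M\<lparr>carrier := ?X\<rparr>) \<subseteq> carrier (line K)"
      using coord j by (auto simp: line_def)
    show "carrier (line K) \<subseteq> (\<lambda>f. f j) ` carrier (M\<lparr>carrier := ?X\<rparr>)"
    proof
      fix x assume "x \<in> carrier (line K)"
      then have "(\<lambda>i\<in>J. if i = j then x else \<zero>\<^bsub>K\<^esub>) \<in> ?X"
        by (auto simp: iff line_def)
      then show "x \<in> (\<lambda>f. f j) ` carrier (M\<lparr>carrier := ?X\<rparr>)" using j
        by (intro image_eqI[where x = "\<lambda>i\<in>J. if i = j then x else \<zero>\<^bsub>K\<^esub>"]) auto
    qed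
  qed
  have "{f \<in> carrier (M\<lparr>carrier := ?X\<rparr>). f j = \<zero>\<^bsub>line K\<^esub>} = supported_on K J T"
  proof (rule Set.set_eqI)
    fix f
    show "f \<in> {f \<in> carrier (M\<lparr>carrier := ?X\<rparr>). f j = \<zero>\<^bsub>line K\<^esub>} \<longleftrightarrow> f \<in> supported_on K J T"
      using insert.hyps j by (auto simp: iff line_def)
  qed
  then have "vectorspace.dim K (M\<lparr>carrier := ?X\<rparr>) = 1 + card T"
    using rank_nullity_surj[OF lin subspace_fin_dim[OF X fd] surj] IH line_dim[OF field_axioms]
    by simp
  then show ?case using X insert.hyps by simp
qed

definition bar_sum :: "('k, 'r) ring_scheme \<Rightarrow> (nat \<times> nat) set \<Rightarrow> (nat \<times> nat \<Rightarrow> nat) \<Rightarrow>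
    (nat, nat, 'k, (nat \<times> nat) \<times> nat \<Rightarrow> 'k) quiver_rep" where
  "bar_sum K B d = direct_sum_rep (Sigma B (\<lambda>b. {0..<d b})) (\<lambda>(b, r). interval_rep K b)"

lemma bar_sum_space:
  fixes B d
  defines "J \<equiv> Sigma B (\<lambda>b. {0..<d b})"
  shows "carrier (vspace (bar_sum K B d) i) = supported_on K J {p. i \<in> {fst (fst p)..snd (fst p)}}"
    "\<zero>\<^bsub>vspace (bar_sum K B d) i\<^esub> = (\<lambda>j\<in>J. \<zero>\<^bsub>K\<^esub>)"
    "f \<oplus>\<^bsub>vspace (bar_sum K B d) i\<^esub> g = (\<lambda>j\<in>J. f j \<oplus>\<^bsub>K\<^esub> g j)"
    "c \<odot>\<^bsub>vspace (bar_sum K B d) i\<^esub> f = (\<lambda>j\<in>J. c \<otimes>\<^bsub>K\<^esub> f j)"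
    "edge_map (bar_sum K B d) i f =
      (\<lambda>p\<in>J. if i - 1 \<in> {fst (fst p)..snd (fst p)} \<and> i \<in> {fst (fst p)..snd (fst p)} then f p else \<zero>\<^bsub>K\<^esub>)"
  unfolding bar_sum_def direct_sum_rep_def interval_rep_def supported_on_def J_def
  by (auto intro!: restrict_ext PiE_cong)

text \<open>A coordinate survives from vertex \<open>0\<close> to vertex \<open>i\<close> exactly if its bar contains both.\<close>

lemma push_bar_sum:
  fixes B d i
  defines "J \<equiv> Sigma B (\<lambda>b. {0..<d b})"
  assumes K: "field K" and f: "f \<in> supported_on K J {p. fst (fst p) = 0}"
  shows "push (bar_sum K B d) i f =
    (\<lambda>p\<in>J. if fst (fst p) = 0 \<and> i \<le> snd (fst p) then f p else \<zero>\<^bsub>K\<^esub>)"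
proof (induction i)
  case 0
  show ?case unfolding push.simps id_apply using f unfolding supported_on_iff[OF K]
    by (intro extensionalityI[of _ J] restrict_extensional) auto
next
  case (Suc i)
  show ?case unfolding push.simps comp_apply Suc.IH bar_sum_space
    unfolding J_def by (intro extensionalityI[OF restrict_extensional restrict_extensional]) auto
qed

lemma push_bar_sum_image:
  fixes B d i
  defines "J \<equiv> Sigma B (\<lambda>b. {0..<d b})"
  assumes K: "field K"
  shows "push (bar_sum K B d) i ` carrier (vspace (bar_sum K B d) 0) =
    supported_on K J {p. fst (fst p) = 0 \<and> i \<le> snd (fst p)}"
proof -
  interpret field K by fact
  have c: "carrier (vspace (bar_sum K B d) 0) = supported_on K J {p. fst (fst p) = 0}"
    by (simp add: bar_sum_space J_def)
  show ?thesis (is "?L = ?R")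
  proof
    show "?L \<subseteq> ?R"
    proof
      fix g assume "g \<in> ?L"
      then obtain f where f: "f \<in> supported_on K J {p. fst (fst p) = 0}"
        and g: "g = push (bar_sum K B d) i f" unfolding c by auto
      show "g \<in> ?R"
        using f unfolding g push_bar_sum[OF K f[unfolded J_def]] supported_on_iff[OF K]
        by (auto simp: J_def)
    qed
    show "?R \<subseteq> ?L"
    proof
      fix f assume f: "f \<in> ?R"
      then have f0: "f \<in> supported_on K J {p. fst (fst p) = 0}"
        unfolding supported_on_iff[OF K] by simp
      have "push (bar_sum K B d) i f = f"
        unfolding push_bar_sum[OF K f0[unfolded J_def]]
        using f unfolding supported_on_iff[OF K]
        unfolding J_def by (intro extensionalityI[OF restrict_extensional]) auto
      then show "f \<in> ?L" unfolding c using f0 by (metis imageI)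
    qed
  qed
qed

lemma card_bars:
  assumes "finite B"
  shows "card {p \<in> Sigma B (\<lambda>b. {0..<d b}). P (fst p)} = (\<Sum>b\<in>{b\<in>B. P b}. d b)"
proof -
  have "{p \<in> Sigma B (\<lambda>b. {0..<d b}). P (fst p)} = Sigma {b\<in>B. P b} (\<lambda>b. {0..<d b})" by auto
  then show ?thesis using assms by simp
qed

lemma barcode_finite: "is_barcode K n V B d \<Longrightarrow> finite B"
  unfolding is_barcode_def
  by (rule finite_subset[of _ "{..n - 1} \<times> {..n - 1}"]) auto

text \<open>Both numbers are computed in the direct sum of interval modules and carried to \<open>V\<close> by the
  isomorphism of representations, which commutes with the composites of the edge maps.\<close>

lemma barcode_dims:
  fixes K :: "('k, 'r) ring_scheme"
  assumes V: "fd_rep K (equi_A n) V" and B: "is_barcode K n V B d" and i: "i < n"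
  shows "vectorspace.dim K (vspace V i) = (\<Sum>b\<in>{b\<in>B. fst b \<le> i \<and> i \<le> snd b}. d b)"
    and "vectorspace.dim K (vspace V i\<lparr>carrier := push V i ` carrier (vspace V 0)\<rparr>) =
      (\<Sum>b\<in>{b\<in>B. fst b = 0 \<and> i \<le> snd b}. d b)"
proof -
  let ?W = "bar_sum K B d" and ?J = "Sigma B (\<lambda>b. {0..<d b})"
  have finB: "finite B" using barcode_finite[OF B] .
  obtain \<phi> where lin: "\<And>x. x < n \<Longrightarrow> linear_map K (vspace V x) (vspace ?W x) (\<phi> x)"
    and bij: "\<And>x. x < n \<Longrightarrow> bij_betw (\<phi> x) (carrier (vspace V x)) (carrier (vspace ?W x))"
    and comm: "\<And>e v. e \<in> {1..<n} \<Longrightarrow> v \<in> carrier (vspace V (e - 1)) \<Longrightarrow>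
      \<phi> e (edge_map V e v) = edge_map ?W e (\<phi> (e - 1) v)"
  proof -
    have "rep_iso K (equi_A n) V ?W" using B by (simp add: is_barcode_def bar_sum_def)
    then obtain \<phi> where
      "\<forall>x\<in>{0..<n}. linear_map K (vspace V x) (vspace ?W x) (\<phi> x) \<and>
        bij_betw (\<phi> x) (carrier (vspace V x)) (carrier (vspace ?W x))"
      "\<forall>e\<in>{1..<n}. \<forall>v\<in>carrier (vspace V (e - 1)).
        \<phi> e (edge_map V e v) = edge_map ?W e (\<phi> (e - 1) v)"
      unfolding rep_iso_def equi_A_simps by blast
    then show thesis by (intro that[of \<phi>]) simp_all
  qed
  note Vi = fd_rep_vertexD[OF V, of i, simplified, OF i]
  have K: "field K" using Vi(1) by (simp add: vectorspace_def)
  have W: "vectorspace K (vspace ?W i)" "vectorspace.fin_dim K (vspace ?W i)"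
    using linear_mapD(2)[OF lin[OF i]] surj_fin_dim[OF lin[OF i] Vi(2)] bij[OF i]
    by (auto simp: bij_betw_def)
  have dimW: "vectorspace.dim K (vspace ?W i\<lparr>carrier := supported_on K ?J T\<rparr>) = card T"
    and subW: "subspace K (supported_on K ?J T) (vspace ?W i)"
    if "T \<subseteq> {p. i \<in> {fst (fst p)..snd (fst p)}}" "T \<subseteq> ?J" for T
    using dim_supported_on[OF W bar_sum_space(1,2,3,4) finite_subset[OF that(2)] that] finB by auto
  have inter: "supported_on K ?J T = supported_on K ?J (?J \<inter> T)" for T
    by (auto simp: supported_on_def intro!: PiE_cong)
  let ?T = "{p\<in>?J. fst (fst p) \<le> i \<and> i \<le> snd (fst p)}"
  have "vspace ?W i\<lparr>carrier := supported_on K ?J ?T\<rparr> = vspace ?W i"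
    using bar_sum_space(1)[of K B d i] inter[of "{p. fst (fst p) \<le> i \<and> i \<le> snd (fst p)}"]
    by (simp add: Int_def)
  then have "vectorspace.dim K (vspace ?W i) = card ?T"
    using dimW[of ?T] by auto
  also have "\<dots> = (\<Sum>b\<in>{b\<in>B. fst b \<le> i \<and> i \<le> snd b}. d b)"
    using card_bars[OF finB, of d "\<lambda>b. fst b \<le> i \<and> i \<le> snd b"] .
  finally show "vectorspace.dim K (vspace V i) = (\<Sum>b\<in>{b\<in>B. fst b \<le> i \<and> i \<le> snd b}. d b)"
    using bij_dim_eq[OF lin[OF i] Vi(2) bij[OF i]] by simp
  have push: "\<phi> k (push V k v) = push ?W k (\<phi> 0 v)" if "k < n" "v \<in> carrier (vspace V 0)" for k v
    using that(1)
  proof (induction k)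
    case (Suc k)
    then have "push V k v \<in> carrier (vspace V k)"
      using linear_mapD(3)[OF push_linear[OF V] that(2)] by simp
    then show ?case using Suc comm[of "Suc k" "push V k v"] by simp
  qed simp
  let ?I = "push V i ` carrier (vspace V 0)"
  let ?T = "{p\<in>?J. fst (fst p) = 0 \<and> i \<le> snd (fst p)}"
  have "\<phi> i ` ?I = push ?W i ` \<phi> 0 ` carrier (vspace V 0)"
    using push[OF i] by (auto simp: image_image)
  also have "\<phi> 0 ` carrier (vspace V 0) = carrier (vspace ?W 0)"
    using bij[of 0] i by (simp add: bij_betw_def)
  also have "push ?W i ` carrier (vspace ?W 0) = supported_on K ?J ?T"
    unfolding push_bar_sum_image[OF K] inter[of "{p. fst (fst p) = 0 \<and> i \<le> snd (fst p)}"]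
    by (simp add: Int_def)
  finally have im: "\<phi> i ` ?I = supported_on K ?J ?T" .
  have I: "subspace K ?I (vspace V i)"
    using subspace_image[OF push_linear[OF V i] subspace_carrier] fd_rep_vertexD(1)[OF V, of 0] i
    by simp
  have "bij_betw (\<phi> i) ?I (supported_on K ?J ?T)"
    using bij_betw_subset[OF bij[OF i] subspaceD(2)[OF I] im] .
  moreover have T: "?T \<subseteq> {p. i \<in> {fst (fst p)..snd (fst p)}}" "?T \<subseteq> ?J" by auto
  ultimately have "vectorspace.dim K (vspace V i\<lparr>carrier := ?I\<rparr>) = card ?T"
    using bij_dim_eq[OF linear_map_restrict[OF lin[OF i] I subW[OF T]]] subspace_fin_dim[OF I Vi(2)]
      im dimW[OF T] by simp
  also have "\<dots> = (\<Sum>b\<in>{b\<in>B. fst b = 0 \<and> i \<le> snd b}. d b)"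
    using card_bars[OF finB, of d "\<lambda>b. fst b = 0 \<and> i \<le> snd b"] .
  finally show "vectorspace.dim K (vspace V i\<lparr>carrier := ?I\<rparr>) =
      (\<Sum>b\<in>{b\<in>B. fst b = 0 \<and> i \<le> snd b}. d b)" .
qed


section \<open>The Harder-Narasimhan filtration\<close>

lemma filtration_step_subrep:
  assumes U: "is_subrep K Q V U" and W: "is_subrep K Q V W" and "\<And>x. x \<in> verts Q \<Longrightarrow> U x \<subseteq> W x"
  shows "is_subrep K Q (restrict_rep V W) U"
  using U assms(3) subspace_nested[OF subrep_vertexD[OF U] subrep_vertexD[OF W]]
  by (auto simp: is_subrep_def restrict_rep_def)

lemma filtration_quot_dim:
  assumes V: "fd_rep K Q V" and U: "is_subrep K Q V (F (k - 1))" and W: "is_subrep K Q V (F k)"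
    and le: "\<And>x. x \<in> verts Q \<Longrightarrow> F (k - 1) x \<subseteq> F k x" and x: "x \<in> verts Q"
  shows "vectorspace.dim K (vspace V x\<lparr>carrier := F k x\<rparr>) =
    vectorspace.dim K (vspace (filtration_quot Q V F k) x) +
    vectorspace.dim K (vspace V x\<lparr>carrier := F (k - 1) x\<rparr>)"
  using quot_dim[OF subspace_nested[OF subrep_vertexD[OF U x] subrep_vertexD[OF W x] le[OF x]]
      subspace_fin_dim[OF subrep_vertexD[OF W x] fd_rep_vertexD(2)[OF V x]]]
  by (simp add: filtration_quot_def quot_rep_def restrict_rep_def)

text \<open>Surjectivity of an edge map is inherited by extensions: an element of \<open>F k\<close> at the head agrees
  with an image from the tail up to an element of \<open>F (k - 1)\<close>, which is an image itself.\<close>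

lemma filtration_quot_edge_surj:
  assumes V: "fd_rep K Q V" and U: "is_subrep K Q V (F (k - 1))" and W: "is_subrep K Q V (F k)"
    and le: "\<And>x. x \<in> verts Q \<Longrightarrow> F (k - 1) x \<subseteq> F k x"
    and e: "e \<in> arcs Q" "tail Q e \<in> verts Q" "head Q e \<in> verts Q"
    and surj: "edge_map (filtration_quot Q V F k) e ` carrier (vspace (filtration_quot Q V F k) (tail Q e))
      = carrier (vspace (filtration_quot Q V F k) (head Q e))"
    and IH: "edge_map V e ` F (k - 1) (tail Q e) = F (k - 1) (head Q e)"
  shows "edge_map V e ` F k (tail Q e) = F k (head Q e)"
proof
  let ?T = "vspace V (tail Q e)" and ?H = "vspace V (head Q e)"
  note T = subrep_vertexD[OF W e(2)] and UT = subrep_vertexD[OF U e(2)]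
  note H = subrep_vertexD[OF W e(3)] and UH = subrep_vertexD[OF U e(3)]
  note f = linear_map_restrict[OF fd_rep_edgeD[OF V e(1)] T H]
  show sub: "edge_map V e ` F k (tail Q e) \<subseteq> F k (head Q e)" using W e(1) by (simp add: is_subrep_def)
  show "F k (head Q e) \<subseteq> edge_map V e ` F k (tail Q e)"
  proof
    fix w assume w: "w \<in> F k (head Q e)"
    let ?U = "F (k - 1) (tail Q e)" and ?U' = "F (k - 1) (head Q e)"
    have "?U' +>\<^bsub>?H\<lparr>carrier := F k (head Q e)\<rparr>\<^esub> w
        \<in> carrier (vspace (filtration_quot Q V F k) (head Q e))"
      using w by (auto simp: filtration_quot_def quot_rep_def restrict_rep_def quot_carrier)
    then obtain v where v: "v \<in> F k (tail Q e)" and eq: "?U' +>\<^bsub>?H\<lparr>carrier := F k (head Q e)\<rparr>\<^esub> w =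
        edge_map (filtration_quot Q V F k) e (?U +>\<^bsub>?T\<lparr>carrier := F k (tail Q e)\<rparr>\<^esub> v)"
      unfolding surj[symmetric]
      by (auto simp: filtration_quot_def quot_rep_def restrict_rep_def quot_carrier)
    have "\<dots> = ?U' +>\<^bsub>?H\<lparr>carrier := F k (head Q e)\<rparr>\<^esub> edge_map V e v"
      using coset_image[OF f[OF sub] subspace_nested[OF UT T le[OF e(2)]]
          subspace_nested[OF UH H le[OF e(3)]], of v] IH v
      by (simp add: filtration_quot_def quot_rep_def restrict_rep_def)
    then have "w \<in> ?U' +>\<^bsub>?H\<lparr>carrier := F k (head Q e)\<rparr>\<^esub> edge_map V e v"
      using coset_eq_iff[OF subspace_nested[OF UH H le[OF e(3)]], of w "edge_map V e v"] eq w v sub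
      by auto
    then obtain u where u: "u \<in> ?U" "w = edge_map V e u \<oplus>\<^bsub>?H\<^esub> edge_map V e v"
      unfolding mem_coset_iff IH[symmetric] by auto
    have uv: "u \<in> F k (tail Q e)" "v \<in> F k (tail Q e)" using u(1) le[OF e(2)] v by auto
    then have "u \<in> carrier ?T" "v \<in> carrier ?T" using subspaceD(2)[OF T] by auto
    then have "w = edge_map V e (u \<oplus>\<^bsub>?T\<^esub> v)"
      using u(2) linear_mapD(4)[OF fd_rep_edgeD[OF V e(1)]] by simp
    then show "w \<in> edge_map V e ` F k (tail Q e)" using subspaceD(4)[OF T uv] by auto
  qed
qed

lemma strict_mono_on_enum_unique:
  fixes c j :: "nat \<Rightarrow> nat"
  assumes c: "strict_mono_on {1..L} c" and j: "strict_mono_on {1..l} j"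
    and eq: "c ` {1..L} = j ` {1..l}"
  shows "L = l" and "k \<in> {1..L} \<Longrightarrow> c k = j k"
proof -
  have "card (c ` {1..L}) = L" "card (j ` {1..l}) = l"
    using card_image strict_mono_on_imp_inj_on[OF c] strict_mono_on_imp_inj_on[OF j] by fastforce+
  then show L: "L = l" using eq by simp
  have "sorted_wrt (<) (map f [1..<Suc L])" if f: "strict_mono_on {1..L} f" for f :: "nat \<Rightarrow> nat"
    unfolding sorted_wrt_map
    by (rule sorted_wrt_mono_rel[OF _ sorted_wrt_upt]) (use strict_mono_onD[OF f] in auto)
  then have "map c [1..<Suc L] = map j [1..<Suc L]"
    using c j eq L by (intro strict_sorted_equal) (auto simp: atLeastLessThanSuc_atLeastAtMost simp del: upt_Suc)
  then show "c k = j k" if "k \<in> {1..L}"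
    using that by (auto simp: atLeastLessThanSuc_atLeastAtMost simp del: upt_Suc)
qed

text \<open>Both sides of the equation give the same function of \<open>i\<close>. Its drop between \<open>i\<close> and \<open>i + 1\<close> is,
  on the left, the sum of the \<open>\<delta> k\<close> with \<open>c k = i\<close>, hence a single \<open>\<delta> k\<close> or \<open>0\<close>, and on the right
  the multiplicity of \<open>(0, i)\<close> or \<open>0\<close>.\<close>

lemma rank_drops_determine:
  fixes c :: "nat \<Rightarrow> nat" and \<delta> :: "nat \<Rightarrow> nat" and B :: "(nat \<times> nat) set"
  assumes B: "finite B" and c: "inj_on c {1..L}"
    and pos: "\<And>k. k \<in> {1..L} \<Longrightarrow> c k < n \<and> 0 < \<delta> k" and bars: "\<And>b. b \<in> B \<Longrightarrow> snd b < n \<and> 0 < d b"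
    and eq: "\<And>i. i < n \<Longrightarrow> (\<Sum>k\<in>{1..L}. if i \<le> c k then \<delta> k else 0) =
      (\<Sum>b\<in>{b\<in>B. fst b = 0 \<and> i \<le> snd b}. d b)"
  shows "c ` {1..L} = {i. (0, i) \<in> B}" and "k \<in> {1..L} \<Longrightarrow> \<delta> k = d (0, c k)"
proof -
  define r where "r i = (\<Sum>k\<in>{1..L}. if i \<le> c k then \<delta> k else 0)" for i
  \<comment> \<open>extended to all \<open>i\<close>, so that the drop at the last vertex \<open>n - 1\<close> needs no separate argument\<close>
  have r_bars: "r i = (\<Sum>b\<in>B. if fst b = 0 \<and> i \<le> snd b then d b else 0)" for i
  proof (cases "i < n")
    case True
    then show ?thesis using eq B by (simp add: r_def sum.inter_filter)
  next
    case False
    have "r i = 0" using pos False by (force simp: r_def)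
    moreover have "(\<Sum>b\<in>B. if fst b = 0 \<and> i \<le> snd b then d b else 0) = 0"
      using bars False by (force intro!: sum.neutral)
    ultimately show ?thesis by simp
  qed
  have drop: "(\<Sum>k\<in>{1..L}. if c k = i then \<delta> k else 0) = (if (0, i) \<in> B then d (0, i) else 0)" for i
  proof -
    have "r i = r (Suc i) + (\<Sum>k\<in>{1..L}. if c k = i then \<delta> k else 0)"
      unfolding r_def sum.distrib[symmetric] by (intro sum.cong) auto
    moreover have "r i = r (Suc i) + (\<Sum>b\<in>B. if b = (0, i) then d b else 0)"
      unfolding r_bars sum.distrib[symmetric] by (intro sum.cong) (auto simp: prod_eq_iff)
    ultimately show ?thesis using B by simp
  qed
  have pt: "(0, c k) \<in> B \<and> \<delta> k = d (0, c k)" if k: "k \<in> {1..L}" for k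
  proof -
    have "(\<Sum>k'\<in>{1..L}. if c k' = c k then \<delta> k' else 0) = (\<Sum>k'\<in>{1..L}. if k' = k then \<delta> k' else 0)"
      using inj_onD[OF c _ _ k] by (intro sum.cong) auto
    also have "\<dots> = \<delta> k" using k by simp
    finally show ?thesis using drop[of "c k"] pos[OF k] by (auto split: if_splits)
  qed
  then show "k \<in> {1..L} \<Longrightarrow> \<delta> k = d (0, c k)" by simp
  show "c ` {1..L} = {i. (0, i) \<in> B}"
  proof (intro equalityI subsetI)
    fix i assume "i \<in> {i. (0, i) \<in> B}"
    then have "(\<Sum>k\<in>{1..L}. if c k = i then \<delta> k else 0) \<noteq> 0"
      using drop[of i] bars[of "(0, i)"] by simp
    then obtain k where "k \<in> {1..L}" "(if c k = i then \<delta> k else 0) \<noteq> 0" by (rule sum.not_neutral_contains_not_neutral)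
    then show "i \<in> c ` {1..L}" by (auto split: if_splits)
  qed (use pt in auto)
qed

text \<open>The number \<open>L\<close> counts the steps of positive slope. The step \<open>F L\<close> contains all of \<open>V\<^sub>0\<close>: if a step
  of slope \<open>0\<close> follows, its quotient vanishes at vertex \<open>0\<close>. As the edge maps of \<open>F L\<close> are
  surjective, \<open>F L\<close> is then generated by \<open>V\<^sub>0\<close>.\<close>

lemma HN_positive_part:
  fixes K F n V
  defines "S k \<equiv> filtration_quot (equi_A n) V F k"
  defines "\<delta> k i \<equiv> vectorspace.dim K (vspace (S k) i)"
  assumes n: "n \<ge> 1" and V: "fd_rep K (equi_A n) V" and nz: "nonzero_rep (equi_A n) V"
    and HN: "HN_filtration K (equi_A n) (euler_stability (equi_A n)) V m F"
  obtains L c where "L \<le> m" "m \<le> Suc L" "strict_mono_on {1..L} c"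
    "\<And>k. k \<in> {1..L} \<Longrightarrow> c k < n \<and> 0 < \<delta> k 0"
    "\<And>k i. k \<in> {1..L} \<Longrightarrow> i < n \<Longrightarrow> \<delta> k i = (if i \<le> c k then \<delta> k 0 else 0)"
    "\<And>i. i < n \<Longrightarrow> F L i = push V i ` carrier (vspace V 0)"
    "\<And>i. i < n \<Longrightarrow> vectorspace.dim K (vspace V i\<lparr>carrier := F L i\<rparr>) = (\<Sum>k\<in>{1..L}. \<delta> k i)"
proof -
  let ?A = "equi_A n" and ?\<epsilon> = "euler_stability (equi_A n)"
  have sub: "is_subrep K ?A V (F k)" if "k \<le> m" for k using HN that by (simp add: HN_filtration_def)
  have F0: "F 0 x = {\<zero>\<^bsub>vspace V x\<^esub>}" and Fm: "F m x = carrier (vspace V x)" if "x < n" for x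
    using HN that by (simp_all add: HN_filtration_def)
  have le: "F (k - 1) x \<subseteq> F k x" if "k \<in> {1..m}" "x \<in> verts ?A" for k x
    using HN that by (simp add: HN_filtration_def)
  have ss: "semistable K ?A ?\<epsilon> (S k)" if "k \<in> {1..m}" for k
    using HN that by (simp add: HN_filtration_def S_def)
  have slopes: "slope K ?A ?\<epsilon> (S (k + 1)) < slope K ?A ?\<epsilon> (S k)" if "k \<in> {1..<m}" for k
    using HN that unfolding HN_filtration_def S_def by blast
  have "m \<noteq> 0" using F0 Fm nz by (auto simp: nonzero_rep_def)
  have S_fd: "fd_rep K ?A (S k)" if "k \<in> {1..m}" for k
    unfolding S_def filtration_quot_def
    using fd_rep_quot[OF fd_rep_restrict[OF V sub[of k] equi_A_wf]
        filtration_step_subrep[OF sub[of "k - 1"] sub[of k] le[OF that]] equi_A_wf] that by auto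
  have dims: "vectorspace.dim K (vspace V x\<lparr>carrier := F k x\<rparr>) =
      \<delta> k x + vectorspace.dim K (vspace V x\<lparr>carrier := F (k - 1) x\<rparr>)"
    if "k \<in> {1..m}" "x < n" for k x
    unfolding \<delta>_def S_def
    using filtration_quot_dim[OF V sub[of "k - 1"] sub[of k] le[OF that(1)], of x] that by auto
  have slope_eq: "slope K ?A ?\<epsilon> (S k) = real (\<delta> k 0) / real (\<Sum>i\<in>{0..<n}. \<delta> k i)" for k
    unfolding slope_equi_A[OF n] \<delta>_def ..
  \<comment> \<open>the numerator of the slope of the last quotient decides whether it counts as positive\<close>
  define L where "L = (if 0 < \<delta> m 0 then m else m - 1)"
  have Lm: "L \<le> m" "m \<le> Suc L" using \<open>m \<noteq> 0\<close> by (auto simp: L_def)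
  have pos: "0 < \<delta> k 0" if k: "k \<in> {1..L}" for k
  proof (cases "k < m")
    case True
    then have "slope K ?A ?\<epsilon> (S (k + 1)) < slope K ?A ?\<epsilon> (S k)" using slopes k by simp
    moreover have "0 \<le> slope K ?A ?\<epsilon> (S (k + 1))" unfolding slope_eq
      by (intro divide_nonneg_nonneg of_nat_0_le_iff)
    ultimately have "0 < slope K ?A ?\<epsilon> (S k)" by simp
    then show ?thesis unfolding slope_eq by (cases "\<delta> k 0 = 0") auto
  next
    case False
    then show ?thesis using k Lm \<open>m \<noteq> 0\<close> by (auto simp: L_def split: if_splits)
  qed
  have km: "k \<in> {1..m}" if "k \<in> {1..L}" for k using that Lm by auto
  have "\<exists>c<n. \<forall>i<n. \<delta> k i = (if i \<le> c then \<delta> k 0 else 0)" if "k \<in> {1..L}" for k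
    using semistable_shape[OF n S_fd[OF km[OF that]] ss[OF km[OF that]]] pos[OF that]
    unfolding \<delta>_def by blast
  then obtain c where c: "\<And>k. k \<in> {1..L} \<Longrightarrow> c k < n"
    and shape: "\<And>k i. k \<in> {1..L} \<Longrightarrow> i < n \<Longrightarrow> \<delta> k i = (if i \<le> c k then \<delta> k 0 else 0)"
    by metis
  have slope_c: "slope K ?A ?\<epsilon> (S k) = 1 / real (Suc (c k))" if k: "k \<in> {1..L}" for k
  proof -
    have "(\<Sum>i\<in>{0..<n}. \<delta> k i) = (\<Sum>i\<in>{0..<n}. if i \<in> {0..c k} then \<delta> k 0 else 0)"
      using shape[OF k] by (intro sum.cong) auto
    also have "\<dots> = (\<Sum>i\<in>{0..<n} \<inter> {0..c k}. \<delta> k 0)" by (simp only: sum.inter_restrict[symmetric] finite_atLeastLessThan)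
    also have "{0..<n} \<inter> {0..c k} = {0..c k}" using c[OF k] by auto
    finally have total: "(\<Sum>i\<in>{0..<n}. \<delta> k i) = Suc (c k) * \<delta> k 0" by simp
    show ?thesis unfolding slope_eq total of_nat_mult using pos[OF k] by (simp del: of_nat_Suc)
  qed
  have c_less: "c k < c (Suc k)" if "k \<in> {1..L}" "Suc k \<in> {1..L}" for k
  proof -
    have "1 / real (Suc (c (Suc k))) < 1 / real (Suc (c k))"
      using slopes[of k] slope_c[OF that(1)] slope_c[OF that(2)] that Lm by simp
    then show ?thesis by (simp add: field_simps)
  qed
  have mono: "strict_mono_on {1..L} c"
  proof (rule strict_mono_onI)
    fix a b assume ab: "a \<in> {1..L}" "b \<in> {1..L}" "a < b"
    have "c a < c b" if "Suc a \<le> b" "b \<le> L" for b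
      using that
    proof (induction b rule: dec_induct)
      case base
      then show ?case using c_less ab by simp
    next
      case (step b)
      then show ?case using c_less[of b] ab by auto
    qed
    then show "c a < c b" using ab by simp
  qed
  have edge: "edge_map V e ` F k (e - 1) = F k e" if "k \<le> L" and e: "e \<in> {1..<n}" for k e
    using \<open>k \<le> L\<close>
  proof (induction k)
    case 0
    have "edge_map V e \<zero>\<^bsub>vspace V (e - 1)\<^esub> = \<zero>\<^bsub>vspace V e\<^esub>"
      using linear_mapD(6)[OF fd_rep_edgeD[OF V, of e, unfolded equi_A_simps, OF e]] .
    moreover have "F 0 (e - 1) = {\<zero>\<^bsub>vspace V (e - 1)\<^esub>}" "F 0 e = {\<zero>\<^bsub>vspace V e\<^esub>}"
      using F0[of "e - 1"] F0[of e] e by auto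
    ultimately show ?case by (simp only: image_insert image_empty)
  next
    case (Suc k)
    then have k: "Suc k \<in> {1..L}" by simp
    obtain i where i: "e = Suc i" using e by (cases e) auto
    have p: "push (S (Suc k)) x ` carrier (vspace (S (Suc k)) 0) = carrier (vspace (S (Suc k)) x)"
      if "x < n" for x
      using semistable_push_surj[OF n S_fd[OF km[OF k]] ss[OF km[OF k]] _ that] pos[OF k]
      by (simp add: \<delta>_def)
    have "i < n" "Suc i < n" using e i by auto
    then have "edge_map (S (Suc k)) e ` carrier (vspace (S (Suc k)) (e - 1)) =
        carrier (vspace (S (Suc k)) e)"
      unfolding i diff_Suc_1 p[OF \<open>i < n\<close>, symmetric] p[OF \<open>Suc i < n\<close>, symmetric] push.simps
      by (intro image_comp)
    moreover have "e - 1 < n" using e by auto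
    ultimately show ?case
      using filtration_quot_edge_surj[OF V sub[of "Suc k - 1"] sub[of "Suc k"] le[OF km[OF k]], of e]
        Suc e k Lm unfolding S_def by auto
  qed
  have FL0: "F L 0 = carrier (vspace V 0)"
  proof (cases "L = m")
    case True
    then show ?thesis using Fm n by simp
  next
    case False
    then have "\<delta> m 0 = 0" "L = m - 1" by (auto simp: L_def split: if_splits)
    then have "vectorspace.dim K (vspace V 0\<lparr>carrier := F L 0\<rparr>) = vectorspace.dim K (vspace V 0)"
      using dims[of m 0] Fm[of 0] n \<open>m \<noteq> 0\<close> by simp
    then show ?thesis
      using dim_le_carrier(2)[OF subrep_vertexD[OF sub[OF Lm(1)], of 0]] fd_rep_vertexD[OF V, of 0] n
      by simp
  qed
  have FL: "F L i = push V i ` carrier (vspace V 0)" if "i < n" for i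
    using that
  proof (induction i)
    case 0
    then show ?case using FL0 by simp
  next
    case (Suc i)
    then show ?case using edge[of L "Suc i"] by (simp add: image_comp)
  qed
  have tele: "vectorspace.dim K (vspace V i\<lparr>carrier := F k i\<rparr>) = (\<Sum>k\<in>{1..k}. \<delta> k i)"
    if "i < n" "k \<le> m" for i k
    using that(2)
  proof (induction k)
    case 0
    then show ?case using F0[OF that(1)] dim_zero_space[OF fd_rep_vertexD(1)[OF V, of i]] that by simp
  next
    case (Suc k)
    then show ?case using dims[of "Suc k" i] that(1) by simp
  qed
  show thesis
    using that[OF Lm mono _ shape FL] c pos tele Lm(1) by blast
qed

theorem mainTheorem1:
  fixes K :: "('k, 'r) ring_scheme"
    and n :: nat
    and V :: "(nat, nat, 'k, 'v) quiver_rep"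
    and Bar :: "(nat \<times> nat) set"
    and d :: "nat \<times> nat \<Rightarrow> nat"
    and l :: nat
    and j :: "nat \<Rightarrow> nat"
    and m :: nat
    and F :: "nat \<Rightarrow> nat \<Rightarrow> 'v set"
  assumes "field K"
    and "n \<ge> 1"
    and "fd_rep K (equi_A n) V"
    and "nonzero_rep (equi_A n) V"
    and "is_barcode K n V Bar d"
    and "strict_mono_on {1..l} j"
    and "j ` {1..l} = {i \<in> {0..<n}. (0, i) \<in> Bar}"
    and "HN_filtration K (equi_A n) (euler_stability (equi_A n)) V m F"
  shows "m = (if \<exists>(u, v)\<in>Bar. 0 < u then l + 1 else l) \<and>
    (\<forall>k. 0 < k \<and> k \<le> l \<longrightarrow> (\<forall>i\<in>{0..<n}.
       vectorspace.dim K (vspace (filtration_quot (equi_A n) V F k) i) =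
         (if i \<le> j k then d (0, j k) else 0)))"
proof -
  note n = assms(2) and V = assms(3) and B = assms(5) and HN = assms(8)
  obtain L c where Lm: "L \<le> m" "m \<le> Suc L" and c: "strict_mono_on {1..L} c"
    and pos: "\<And>k. k \<in> {1..L} \<Longrightarrow>
      c k < n \<and> 0 < vectorspace.dim K (vspace (filtration_quot (equi_A n) V F k) 0)"
    and shape: "\<And>k i. k \<in> {1..L} \<Longrightarrow> i < n \<Longrightarrow>
      vectorspace.dim K (vspace (filtration_quot (equi_A n) V F k) i) =
      (if i \<le> c k then vectorspace.dim K (vspace (filtration_quot (equi_A n) V F k) 0) else 0)"
    and FL: "\<And>i. i < n \<Longrightarrow> F L i = push V i ` carrier (vspace V 0)"
    and dim_FL: "\<And>i. i < n \<Longrightarrow> vectorspace.dim K (vspace V i\<lparr>carrier := F L i\<rparr>) =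
      (\<Sum>k\<in>{1..L}. vectorspace.dim K (vspace (filtration_quot (equi_A n) V F k) i))"
    by (rule HN_positive_part[OF n V assms(4) HN]) blast
  let ?\<delta> = "\<lambda>k. vectorspace.dim K (vspace (filtration_quot (equi_A n) V F k) 0)"
  note dims = barcode_dims[OF V B]
  have finB: "finite Bar" using barcode_finite[OF B] .
  have bars: "fst b \<le> snd b \<and> snd b < n \<and> 0 < d b" if "b \<in> Bar" for b
    using B that n by (fastforce simp: is_barcode_def)
  have ranks: "(\<Sum>k\<in>{1..L}. if i \<le> c k then ?\<delta> k else 0) =
      (\<Sum>b\<in>{b\<in>Bar. fst b = 0 \<and> i \<le> snd b}. d b)" if "i < n" for i
    using dims(2)[OF that] dim_FL[OF that] FL[OF that] shape that by simp
  have drops: "c ` {1..L} = {i. (0, i) \<in> Bar}" "\<And>k. k \<in> {1..L} \<Longrightarrow> ?\<delta> k = d (0, c k)"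
    using rank_drops_determine[OF finB strict_mono_on_imp_inj_on[OF c], of n ?\<delta> d] pos bars ranks
    by blast+
  have "c ` {1..L} = j ` {1..l}"
    using drops(1) assms(7) bars by force
  note uniq = strict_mono_on_enum_unique[OF c assms(6) this]
  have strict: "\<exists>i<n. F L i \<noteq> carrier (vspace V i)" if mL: "m = Suc L"
  proof -
    have "\<forall>k\<in>{1..m}. \<exists>x\<in>verts (equi_A n). F (k - 1) x \<noteq> F k x"
      and top: "\<forall>x\<in>verts (equi_A n). F m x = carrier (vspace V x)"
      using HN unfolding HN_filtration_def by blast+
    from this(1) have "\<exists>x\<in>verts (equi_A n). F (m - 1) x \<noteq> F m x" by (rule bspec) (simp add: mL)
    then show ?thesis using mL top by auto
  qed
  have sub: "{b\<in>Bar. fst b = 0 \<and> i \<le> snd b} \<subseteq> {b\<in>Bar. fst b \<le> i \<and> i \<le> snd b}" for i by auto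
  \<comment> \<open>at vertex \<open>i\<close>, the step \<open>F L\<close> misses exactly the bars through \<open>i\<close> that start after \<open>0\<close>\<close>
  have full: "F L i = carrier (vspace V i) \<longleftrightarrow> (\<forall>b\<in>Bar. fst b \<le> i \<and> i \<le> snd b \<longrightarrow> fst b = 0)"
    if i: "i < n" for i
  proof -
    have "subspace K (F L i) (vspace V i)"
      using HN Lm(1) i by (auto simp: HN_filtration_def is_subrep_def)
    then have "F L i = carrier (vspace V i) \<longleftrightarrow>
        vectorspace.dim K (vspace V i\<lparr>carrier := F L i\<rparr>) = vectorspace.dim K (vspace V i)"
      using dim_le_carrier(2) fd_rep_vertexD(2)[OF V, of i] i by auto
    also have "\<dots> \<longleftrightarrow> (\<Sum>b\<in>{b\<in>Bar. fst b = 0 \<and> i \<le> snd b}. d b) =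
        (\<Sum>b\<in>{b\<in>Bar. fst b \<le> i \<and> i \<le> snd b}. d b)"
      using dims[OF i] FL[OF i] by simp
    also have "\<dots> \<longleftrightarrow> (\<Sum>b\<in>{b\<in>Bar. fst b \<le> i \<and> i \<le> snd b} - {b\<in>Bar. fst b = 0 \<and> i \<le> snd b}. d b) = 0"
      using sum.subset_diff[OF sub[of i], of d] finB by auto
    also have "\<dots> \<longleftrightarrow> (\<forall>b\<in>Bar. fst b \<le> i \<and> i \<le> snd b \<longrightarrow> fst b = 0)"
      using finB bars by force
    finally show ?thesis .
  qed
  have "m = L \<longleftrightarrow> \<not> (\<exists>(u, v)\<in>Bar. 0 < u)"
  proof
    assume "m = L"
    then have all: "F L i = carrier (vspace V i)" if "i < n" for i
      using HN that by (simp add: HN_filtration_def)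
    have "u = 0" if uv: "(u, v) \<in> Bar" for u v
    proof -
      have "u \<le> v" "u < n" using bars[OF uv] by auto
      then show ?thesis using full[of u] all[of u] uv by force
    qed
    then show "\<not> (\<exists>(u, v)\<in>Bar. 0 < u)" by force
  next
    assume "\<not> (\<exists>(u, v)\<in>Bar. 0 < u)"
    then have "F L i = carrier (vspace V i)" if "i < n" for i
      using full[OF that] by auto
    then have "m \<noteq> Suc L" using strict by blast
    then show "m = L" using Lm by simp
  qed
  then have "m = (if \<exists>(u, v)\<in>Bar. 0 < u then l + 1 else l)"
    using Lm uniq(1) by auto
  moreover have "vectorspace.dim K (vspace (filtration_quot (equi_A n) V F k) i) =
      (if i \<le> j k then d (0, j k) else 0)" if "0 < k \<and> k \<le> l" "i \<in> {0..<n}" for k i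
    using shape[of k i] drops(2)[of k] uniq that by auto
  ultimately show ?thesis by blast
qed

end
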